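(* Let $\kappa$ be an infinite regular cardinal, and let $(P,<_P)$ be a partially ordered set satisfying $P\to(2^{<\kappa})^1_{2^{<\kappa}}$. Then for every ordinal $\xi$ with $2^{|\xi|}<\kappa$ and every natural number $k$, we have $P\to(\kappa+\xi)^2_k$.
   Context: For a partial order $P$, an ordinal $\alpha$ and a positive integer $r$, $[P]^r$ denotes the set of $r$-element chains of $P$. For a cardinal $\mu$ and ordinal $\alpha$, $P\to(\alpha)^r_\mu$ means: for every colouring $c:[P]^r\to\mu$ there is a chain $X\subseteq P$ of order type $\alpha$ such that $c$ is constant on $[X]^r$. (So $P\to(\lambda)^1_\lambda$ means that for every $f:P\to\lambda$ there is a chain of order type $\lambda$ on which $f$ is constant.) For a cardinal $\nu\ge2$ and infinite $\kappa$, $\nu^{<\kappa}=\sup_{\mu<\kappa}\nu^\mu$ over cardinals $\mu<\kappa$. *)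

theory Defs
  imports "HOL-Library.FuncSet"
begin

unbundle cardinal_syntax

text \<open>
  Ordinals are represented by well-order relations and cardinals by cardinal-order
  relations (initial ordinals), as in the BNF cardinal theories. A partially ordered set
  is a reflexive relation \<open>r\<close> with \<open>Partial_order r\<close>; its carrier is \<open>Field r\<close>.
\<close>

definition is_card_sup :: "'a rel set \<Rightarrow> 'a rel \<Rightarrow> bool" where
  "is_card_sup S l \<longleftrightarrow> Card_order l \<and> (\<forall>m\<in>S. m \<le>o l) \<and>
     (\<forall>l'::'a rel. Card_order l' \<and> (\<forall>m\<in>S. m \<le>o l') \<longrightarrow> l \<le>o l')"

text \<open>
  The weak power \<open>\<nu>\<close> to the \<open><\<kappa>\<close>. Every cardinal below \<open>\<kappa>\<close> has a representative on the
  underlying type of \<open>\<kappa>\<close>, so letting \<open>\<mu>\<close> range over relations on that type loses nothing.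
  The supremum is unique up to order isomorphism; a representative is chosen.
\<close>

definition weak_power :: "'n rel \<Rightarrow> 'k rel \<Rightarrow> ('k \<Rightarrow> 'n) rel" where
  "weak_power \<nu> \<kappa> = (SOME l. is_card_sup {\<nu> ^c \<mu> | \<mu> :: 'k rel. Card_order \<mu> \<and> \<mu> <o \<kappa>} l)"

text \<open>The supremum exists, and it is least among upper bounds on any type.\<close>

lemma is_card_sup_exists:
  fixes S :: "'a rel set"
  assumes "\<And>m. m \<in> S \<Longrightarrow> Card_order m"
  shows "\<exists>l. is_card_sup S l"
proof -
  define U where "U = {l :: 'a rel. Card_order l \<and> (\<forall>m\<in>S. m \<le>o l)}"
  have "m \<le>o |UNIV :: 'a set|" if "m \<in> S" for m
    using assms[OF that] card_of_mono1[of "Field m" UNIV]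
    by (meson card_of_Field_ordIso ordIso_ordLeq_trans ordIso_symmetric subset_UNIV)
  then have "|UNIV :: 'a set| \<in> U"
    by (simp add: U_def card_of_Card_order)
  then obtain l where l: "l \<in> U" and min: "\<And>l'. (l', l) \<in> ordLess \<Longrightarrow> l' \<notin> U"
    using wfE_min[OF wf_ordLess] by metis
  have "l \<le>o l'" if "l' \<in> U" for l'
    using min that l unfolding U_def
    by (metis (mono_tags, lifting) card_order_on_well_order_on mem_Collect_eq not_ordLess_iff_ordLeq)
  with l show ?thesis
    unfolding is_card_sup_def U_def by auto
qed

lemma is_card_sup_least:
  fixes S :: "'a rel set" and l' :: "'b rel"
  assumes "is_card_sup S l" and "Card_order l'" and ub: "\<And>m. m \<in> S \<Longrightarrow> m \<le>o l'"
  shows "l \<le>o l'"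
proof (rule ccontr)
  assume "\<not> l \<le>o l'"
  then have less: "l' <o l"
    using assms by (meson card_order_on_well_order_on is_card_sup_def not_ordLeq_iff_ordLess)
  then have "|Field l'| \<le>o |Field l|"
    by (meson card_of_mono2 ordLess_imp_ordLeq)
  then obtain f where f: "inj_on f (Field l')" "f ` Field l' \<subseteq> Field l"
    by (meson card_of_ordLeq)
  define l'' where "l'' = |f ` Field l'|"
  have "|Field l'| =o l''"
    unfolding l''_def using f(1) card_of_ordIso[of "Field l'" "f ` Field l'"]
    by (auto simp: bij_betw_def)
  then have iso: "l' =o l''"
    using card_of_Field_ordIso[OF assms(2)] by (meson ordIso_symmetric ordIso_transitive)
  then have "\<forall>m\<in>S. m \<le>o l''"
    using ub by (meson ordLeq_ordIso_trans)
  then have "l \<le>o l''"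
    using assms(1) unfolding is_card_sup_def l''_def by (simp add: card_of_Card_order)
  then have "l \<le>o l'"
    using iso by (meson ordIso_symmetric ordLeq_ordIso_trans)
  with \<open>\<not> l \<le>o l'\<close> show False by blast
qed

lemma weak_power_is_card_sup:
  fixes \<nu> :: "'n rel" and \<kappa> :: "'k rel"
  shows "is_card_sup {\<nu> ^c \<mu> | \<mu> :: 'k rel. Card_order \<mu> \<and> \<mu> <o \<kappa>} (weak_power \<nu> \<kappa>)"
  unfolding weak_power_def
  by (rule someI_ex, rule is_card_sup_exists) (auto simp: Card_order_cexp)

text \<open>Ordinal sum: a copy of \<open>\<beta>\<close> placed after a copy of \<open>\<alpha>\<close>.\<close>

definition ord_plus :: "'a rel \<Rightarrow> 'b rel \<Rightarrow> ('a + 'b) rel" where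
  "ord_plus \<alpha> \<beta> = {(Inl x, Inl y) | x y. (x, y) \<in> \<alpha>} \<union> {(Inr x, Inr y) | x y. (x, y) \<in> \<beta>} \<union>
     {(Inl x, Inr y) | x y. x \<in> Field \<alpha> \<and> y \<in> Field \<beta>}"

text \<open>Finiteness matters only for \<open>n = 0\<close>, as infinite sets have \<open>card\<close> zero.\<close>

definition nchains :: "'p rel \<Rightarrow> nat \<Rightarrow> 'p set set" where
  "nchains r n = {X \<in> Chains r. finite X \<and> card X = n}"

text \<open>
  The partition relation: every colouring of the \<open>n\<close>-element chains of \<open>r\<close> with colours in
  \<open>\<mu>\<close> is constant on the \<open>n\<close>-element subsets of some chain of order type \<open>\<alpha>\<close>.
\<close>

definition chain_arrow :: "'p rel \<Rightarrow> 'a rel \<Rightarrow> nat \<Rightarrow> 'm rel \<Rightarrow> bool" where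
  "chain_arrow r \<alpha> n \<mu> \<longleftrightarrow>
     (\<forall>c. c \<in> nchains r n \<rightarrow> Field \<mu> \<longrightarrow>
        (\<exists>X\<in>Chains r. Restr r X =o \<alpha> \<and>
           (\<exists>i. \<forall>Y\<in>nchains (Restr r X) n. c Y = i)))"

end

theory Submission
  imports Defs "HOL-Library.Countable"
begin

text \<open>
  Let \<open>\<mu> = 2\<^sup><\<^sup>\<kappa>\<close>. Replace \<open>P\<close> by the tree of its well-ordered subsets with a greatest element,
  ordered by end extension and coloured through the greatest elements. The arrow hypothesis on \<open>P\<close>
  implies that this tree is not a union of \<open>\<mu>\<close> antichains. As \<open>\<mu>\<^sup><\<^sup>\<kappa> = \<mu>\<close>, it follows that the
  tree is not negligible, where a set is negligible if each of its points is determined, within any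
  chain, by fewer than \<open>\<kappa>\<close> points below it and a number.

  On the tree one argues as Baumgartner, Hajnal and Todorcevic do for the ordinal \<open>\<mu>\<^sup>+\<close>. For
  a sequence \<open>\<sigma>\<close> of colours, call \<open>X\<close> \<open>\<sigma>\<close>-positive at \<open>t\<close> if it lies largely below \<open>t\<close> in the
  iterated sense prescribed by \<open>\<sigma>\<close>. A \<open>\<sigma>\<close>-positive set contains a homogeneous chain of type \<open>\<kappa>\<close> in
  every colour of \<open>\<sigma>\<close>, and also a small set \<open>B\<close> such that every function \<open>B \<rightarrow> \<sigma>\<close> is constantly
  \<open>j\<close> on some \<open>j\<close>-homogeneous chain of type \<open>\<xi>\<close>. Take such a \<open>B\<close> above \<open>\<alpha>\<close>: there are fewer than \<open>\<kappa>\<close>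
  ways to colour the pairs from a point below \<open>\<alpha>\<close> to \<open>B\<close>, so one of them occurs positively often below
  \<open>\<alpha>\<close>. Either this gives a homogeneous chain of type \<open>\<kappa> + \<xi>\<close>, or a colour outside \<open>\<sigma>\<close> is positive.
  In the latter case \<open>\<sigma>\<close> can be prolonged by a new colour, which can happen at most \<open>k\<close> times.
\<close>

section \<open>Cardinal and order preliminaries\<close>

lemma small_finite: "Cinfinite r \<Longrightarrow> finite A \<Longrightarrow> |A| <o r"
  by (auto simp: cinfinite_def card_order_on_well_order_on card_of_well_order_on Field_card_of
      intro!: finite_ordLess_infinite)

lemma small_subset: "|B| <o r \<Longrightarrow> A \<subseteq> B \<Longrightarrow> |A| <o r"
  by (rule ordLeq_ordLess_trans[OF card_of_mono1])

lemma small_image: "|A| <o r \<Longrightarrow> |f ` A| <o r"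
  by (rule ordLeq_ordLess_trans[OF card_of_image])

lemma small_Un: "Cinfinite r \<Longrightarrow> |A| <o r \<Longrightarrow> |B| <o r \<Longrightarrow> |A \<union> B| <o r"
  by (simp add: card_of_Un_ordLess_infinite_Field cinfinite_def)

lemma small_UN:
  "Cinfinite r \<Longrightarrow> regularCard r \<Longrightarrow> |I| <o r \<Longrightarrow> (\<And>i. i \<in> I \<Longrightarrow> |A i| <o r) \<Longrightarrow> |\<Union>i\<in>I. A i| <o r"
  by (meson stable_UNION regularCard_stable cinfinite_def)

lemma card_of_Pow_ordLeq: "|A| \<le>o |B| \<Longrightarrow> |Pow A| \<le>o |Pow B|"
proof -
  assume "|A| \<le>o |B|"
  then obtain f where "inj_on f A" "f ` A \<subseteq> B"
    by (meson card_of_ordLeq)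
  then have "inj_on (image f) (Pow A)" "image f ` Pow A \<subseteq> Pow B"
    by (auto intro: inj_on_image_Pow)
  then show ?thesis by (meson card_of_ordLeq)
qed

lemma small_bounded:
  assumes "Cinfinite r" "regularCard r" "K \<subseteq> Field r" "|K| <o r"
  shows "\<exists>a\<in>Field r. \<forall>b\<in>K. (b, a) \<in> r"
proof -
  have "\<not> cofinal K r"
    using assms not_ordLess_ordIso unfolding regularCard_def by blast
  then obtain a where a: "a \<in> Field r" "\<And>b. b \<in> K \<Longrightarrow> a = b \<or> (a, b) \<notin> r"
    unfolding cofinal_def by auto
  have "Well_order r" using assms card_order_on_well_order_on by auto
  then have "Refl r" "Total r"
    unfolding order_on_defs by auto
  then have "(b, a) \<in> r" if "b \<in> K" for b
    using a that assms(3) unfolding refl_on_def total_on_def by (metis subsetD)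
  with a show ?thesis by blast
qed

lemma wf_strict_part:
  assumes "Well_order r"
  shows "wf (r - Id)"
  using assms unfolding order_on_defs by auto

text \<open>Totality of \<open>r\<close> turns strict monotonicity into order reflection, so
  \<open>m\<close> is an isomorphism onto its image. Its last hypothesis covers a one-point
  \<open>r\<close>, where no strict pair puts the image into \<open>Field P\<close>.\<close>

lemma well_order_iso_image:
  assumes "Well_order r" and "Partial_order P"
    and m: "\<And>a b. (a, b) \<in> r \<Longrightarrow> a \<noteq> b \<Longrightarrow> (m a, m b) \<in> P - Id"
    and F: "\<And>a. a \<in> Field r \<Longrightarrow> m a \<in> Field P"
  shows "m ` Field r \<in> Chains P" and "Restr P (m ` Field r) =o r"
proof -
  have P: "Refl P" "antisym P" "trans P"
    using assms(2) unfolding order_on_defs by auto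
  have r: "Refl r" "Total r"
    using assms(1) unfolding order_on_defs by auto
  have inj: "inj_on m (Field r)"
    using m r(2) unfolding inj_on_def total_on_def by fastforce
  have tot: "(a, b) \<in> r \<or> (b, a) \<in> r" if "a \<in> Field r" "b \<in> Field r" for a b
    using r that unfolding total_on_def refl_on_def by metis
  have mono: "(m a, m b) \<in> P" if "(a, b) \<in> r" for a b
    using m[OF that] F[of a] P(1) that unfolding refl_on_def Field_def by (cases "a = b") auto
  show "m ` Field r \<in> Chains P"
    unfolding Chains_def using tot mono by blast
  have iff: "(a, b) \<in> r \<longleftrightarrow> (m a, m b) \<in> P" if ab: "a \<in> Field r" "b \<in> Field r" for a b
  proof
    assume "(m a, m b) \<in> P"
    show "(a, b) \<in> r"
    proof (rule ccontr)
      assume "(a, b) \<notin> r"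
      then have "(b, a) \<in> r" "a \<noteq> b" using tot ab by auto
      then have "(m b, m a) \<in> P - Id" by (auto dest: m)
      with \<open>(m a, m b) \<in> P\<close> show False using P(2) unfolding antisym_def by blast
    qed
  qed (rule mono)
  have "Restr P (m ` Field r) = dir_image r m"
    unfolding dir_image_def using iff mono by (auto intro: FieldI1 FieldI2)
  then show "Restr P (m ` Field r) =o r"
    using dir_image_ordIso[OF assms(1) inj] by (metis ordIso_symmetric)
qed

section \<open>The cardinal 2^{<\<kappa>} and its small subsets\<close>

text \<open>A concrete set whose cardinality is \<open>2\<^sup><\<^sup>\<kappa>\<close>.\<close>

definition bounded_subsets :: "'k rel \<Rightarrow> 'k set set" where
  "bounded_subsets \<kappa> = (\<Union>a\<in>Field \<kappa>. Pow (underS \<kappa> a))"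

lemma small_imp_underS:
  assumes "Card_order \<kappa>" "|A| <o \<kappa>"
  shows "\<exists>b\<in>Field \<kappa>. |A| \<le>o |underS \<kappa> b|"
proof -
  have "Well_order \<kappa>" using assms(1) card_order_on_well_order_on by blast
  then obtain b where b: "b \<in> Field \<kappa>" "|A| =o Restr \<kappa> (underS \<kappa> b)"
    using assms(2) ordLess_iff_ordIso_Restr[of \<kappa> "|A|"] card_of_Well_order by blast
  from card_of_cong[OF b(2)] have "|A| =o |Field (Restr \<kappa> (underS \<kappa> b))|"
    by (simp add: Field_card_of)
  also have "|Field (Restr \<kappa> (underS \<kappa> b))| \<le>o |underS \<kappa> b|"
    by (rule card_of_mono1[OF Field_Restr_subset])
  finally show ?thesis using b(1) by blast
qed

lemma card_of_Pow_ctwo: "|Pow A| =o ctwo ^c |A|"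
  unfolding cexp_def ctwo_def by (simp add: Field_card_of card_of_Pow_Func)

lemma card_Field_le_bounded_subsets:
  assumes "Cinfinite \<kappa>"
  shows "|Field \<kappa>| \<le>o |bounded_subsets \<kappa>|"
proof -
  have r: "Refl \<kappa>" "Total \<kappa>" "antisym \<kappa>"
    using assms card_order_on_well_order_on[of "Field \<kappa>" \<kappa>] unfolding order_on_defs by auto
  have "inj_on (underS \<kappa>) (Field \<kappa>)"
  proof (rule inj_onI)
    fix a b assume ab: "a \<in> Field \<kappa>" "b \<in> Field \<kappa>" and eq: "underS \<kappa> a = underS \<kappa> b"
    have "a \<notin> underS \<kappa> a" "b \<notin> underS \<kappa> b" by (auto simp: underS_def)
    then have "a \<notin> underS \<kappa> b" "b \<notin> underS \<kappa> a" using eq by auto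
    then show "a = b" using ab r(2) unfolding underS_def total_on_def by blast
  qed
  moreover have "underS \<kappa> ` Field \<kappa> \<subseteq> bounded_subsets \<kappa>"
    unfolding bounded_subsets_def by auto
  ultimately show ?thesis by (meson card_of_ordLeq)
qed

lemma card_Pow_le_bounded_subsets:
  assumes "Cinfinite \<kappa>" "|A| <o \<kappa>"
  shows "|Pow A| \<le>o |bounded_subsets \<kappa>|"
proof -
  from small_imp_underS[OF conjunct2[OF assms(1)] assms(2)]
  obtain b where b: "b \<in> Field \<kappa>" "|A| \<le>o |underS \<kappa> b|" by blast
  have "|Pow A| \<le>o |Pow (underS \<kappa> b)|" by (rule card_of_Pow_ordLeq[OF b(2)])
  also have "|Pow (underS \<kappa> b)| \<le>o |bounded_subsets \<kappa>|"
    by (rule card_of_mono1) (use b(1) in \<open>auto simp: bounded_subsets_def\<close>)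
  finally show ?thesis .
qed

lemma infinite_bounded_subsets:
  assumes "Cinfinite \<kappa>"
  shows "infinite (bounded_subsets \<kappa>)"
  using card_of_ordLeq_infinite[OF card_Field_le_bounded_subsets[OF assms]] assms
  unfolding cinfinite_def by blast

lemma bounded_subsets_le_weak_power:
  fixes \<kappa> :: "'k rel"
  assumes \<kappa>: "Cinfinite \<kappa>"
  shows "Cinfinite (weak_power ctwo \<kappa>)" and "|bounded_subsets \<kappa>| \<le>o weak_power ctwo \<kappa>"
proof -
  let ?l = "weak_power ctwo \<kappa>"
  have l: "Card_order ?l" and ub: "\<And>\<mu> :: 'k rel. Card_order \<mu> \<Longrightarrow> \<mu> <o \<kappa> \<Longrightarrow> ctwo ^c \<mu> \<le>o ?l"
    using weak_power_is_card_sup[of ctwo \<kappa>] unfolding is_card_sup_def by auto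
  have Pow: "|Pow A| \<le>o ?l" if "|A| <o \<kappa>" for A :: "'k set"
    using ordIso_ordLeq_trans[OF card_of_Pow_ctwo ub[OF card_of_Card_order that]] .
  \<comment> \<open>Otherwise the weak power would be no larger than an initial segment of \<kappa>,
    but by Cantor that segment is strictly smaller than its power set, hence smaller than the weak
    power.\<close>
  have \<kappa>l: "\<kappa> \<le>o ?l"
  proof (rule ccontr)
    assume "\<not> \<kappa> \<le>o ?l"
    moreover have "Well_order ?l" "Well_order \<kappa>"
      using l \<kappa> card_order_on_well_order_on by auto
    ultimately have "?l <o \<kappa>" using not_ordLeq_iff_ordLess by blast
    then have "|Field ?l| <o \<kappa>"
      by (rule ordIso_ordLess_trans[OF card_of_Field_ordIso[OF l]])
    from small_imp_underS[OF conjunct2[OF \<kappa>] this]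
    obtain b where b: "b \<in> Field \<kappa>" "|Field ?l| \<le>o |underS \<kappa> b|" by blast
    have "|underS \<kappa> b| <o ?l"
      by (rule ordLess_ordLeq_trans[OF card_of_Pow Pow[OF card_of_underS[OF conjunct2[OF \<kappa>] b(1)]]])
    moreover have "?l \<le>o |underS \<kappa> b|"
      using b(2) ordIso_ordLeq_trans[OF ordIso_symmetric[OF card_of_Field_ordIso[OF l]]] by blast
    ultimately show False using not_ordLess_ordLeq by blast
  qed
  show inf: "Cinfinite ?l"
    using cinfinite_mono[OF \<kappa>l conjunct1[OF \<kappa>]] l by blast
  have "|Field \<kappa>| \<le>o ?l"
    by (rule ordIso_ordLeq_trans[OF card_of_Field_ordIso[OF conjunct2[OF \<kappa>]] \<kappa>l])
  moreover have "\<forall>a\<in>Field \<kappa>. |Pow (underS \<kappa> a)| \<le>o ?l"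
    by (intro ballI Pow card_of_underS[OF conjunct2[OF \<kappa>]])
  ultimately show "|bounded_subsets \<kappa>| \<le>o ?l"
    unfolding bounded_subsets_def
    by (rule card_of_UNION_ordLeq_infinite_Field[OF conjunct1[OF inf[unfolded cinfinite_def]] l])
qed

text \<open>The nontrivial half of (2^{<\<kappa>})^{<\<kappa>} = 2^{<\<kappa>}. By regularity the
  members of a small \<open>Z\<close> have a common bound \<open>a\<close>. Indexed by a subset of
  some \<open>underS \<kappa> b\<close>, they are the sections of a relation inside
  \<open>underS \<kappa> b \<times> underS \<kappa> a\<close>, and for fixed \<open>a\<close> and
  \<open>b\<close> there are at most 2^{<\<kappa>} such relations.\<close>

lemma card_small_sets_le_bounded_subsets:
  fixes \<kappa> :: "'k rel"
  assumes \<kappa>: "Cinfinite \<kappa>" "regularCard \<kappa>"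
  shows "|{Z. Z \<subseteq> bounded_subsets \<kappa> \<and> |Z| <o \<kappa>}| \<le>o |bounded_subsets \<kappa>|" (is "|?S| \<le>o |?W|")
proof -
  have inf: "infinite ?W" by (rule infinite_bounded_subsets[OF \<kappa>(1)])
  have tr: "trans \<kappa>" "antisym \<kappa>"
    using \<kappa> card_order_on_well_order_on[of "Field \<kappa>" \<kappa>] unfolding order_on_defs by auto
  define dec where "dec = (\<lambda>(I :: 'k set, R :: 'k rel). (\<lambda>i. R `` {i}) ` I)"
  define C where "C b a = dec ` (Pow (underS \<kappa> b) \<times> Pow (underS \<kappa> b \<times> underS \<kappa> a))" for a b
  have "?S \<subseteq> (\<Union>b\<in>Field \<kappa>. \<Union>a\<in>Field \<kappa>. C b a)"
  proof
    fix Z assume "Z \<in> ?S"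
    then have Z: "Z \<subseteq> ?W" "|Z| <o \<kappa>" by auto
    have "\<forall>S\<in>Z. \<exists>a. a \<in> Field \<kappa> \<and> S \<subseteq> underS \<kappa> a"
      using Z(1) unfolding bounded_subsets_def by blast
    then obtain h where h: "\<And>S. S \<in> Z \<Longrightarrow> h S \<in> Field \<kappa>" "\<And>S. S \<in> Z \<Longrightarrow> S \<subseteq> underS \<kappa> (h S)"
      by metis
    obtain a where a: "a \<in> Field \<kappa>" "\<forall>b\<in>h ` Z. (b, a) \<in> \<kappa>"
      using small_bounded[OF \<kappa>, of "h ` Z"] small_image[OF Z(2)] h(1) by blast
    have Za: "S \<subseteq> underS \<kappa> a" if "S \<in> Z" for S
      using h(2)[OF that] underS_incr[OF tr, of "h S" a] a(2) that by blast
    from small_imp_underS[OF conjunct2[OF \<kappa>(1)] Z(2)]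
    obtain b where b: "b \<in> Field \<kappa>" "|Z| \<le>o |underS \<kappa> b|" by blast
    obtain g where g: "inj_on g Z" "g ` Z \<subseteq> underS \<kappa> b"
      using b(2) by (meson card_of_ordLeq)
    let ?R = "{(g S, x) | S x. S \<in> Z \<and> x \<in> S}"
    have "?R `` {g S} = S" if "S \<in> Z" for S
      using g(1) that unfolding inj_on_def by auto
    then have "(\<lambda>i. ?R `` {i}) ` (g ` Z) = Z"
      by (simp add: image_image)
    then have "Z = dec (g ` Z, ?R)" unfolding dec_def by simp
    moreover have "?R \<subseteq> underS \<kappa> b \<times> underS \<kappa> a"
      using g(2) Za by auto
    ultimately have "Z \<in> C b a"
      unfolding C_def using g(2) by blast
    then show "Z \<in> (\<Union>b\<in>Field \<kappa>. \<Union>a\<in>Field \<kappa>. C b a)" using a(1) b(1) by blast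
  qed
  then have "|?S| \<le>o |\<Union>b\<in>Field \<kappa>. \<Union>a\<in>Field \<kappa>. C b a|" by (rule card_of_mono1)
  also have "|\<Union>b\<in>Field \<kappa>. \<Union>a\<in>Field \<kappa>. C b a| \<le>o |?W|"
  proof (rule card_of_UNION_ordLeq_infinite[OF inf card_Field_le_bounded_subsets[OF \<kappa>(1)]], rule ballI,
      rule card_of_UNION_ordLeq_infinite[OF inf card_Field_le_bounded_subsets[OF \<kappa>(1)]], rule ballI)
    fix a b assume ab: "a \<in> Field \<kappa>" "b \<in> Field \<kappa>"
    have u: "|underS \<kappa> a| <o \<kappa>" "|underS \<kappa> b| <o \<kappa>"
      by (rule card_of_underS[OF conjunct2[OF \<kappa>(1)] ab(1)], rule card_of_underS[OF conjunct2[OF \<kappa>(1)] ab(2)])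
    then have "|underS \<kappa> b \<times> underS \<kappa> a| <o \<kappa>"
      using stable_elim[OF regularCard_stable[OF _ _ \<kappa>(2)] u(2), of "\<lambda>_. underS \<kappa> a"] \<kappa>(1) u(1)
      unfolding cinfinite_def by simp
    then have "|Pow (underS \<kappa> b \<times> underS \<kappa> a)| \<le>o |?W|"
      by (rule card_Pow_le_bounded_subsets[OF \<kappa>(1)])
    moreover have "|Pow (underS \<kappa> b)| \<le>o |?W|"
      by (rule card_Pow_le_bounded_subsets[OF \<kappa>(1) u(2)])
    ultimately have "|Pow (underS \<kappa> b) \<times> Pow (underS \<kappa> b \<times> underS \<kappa> a)| \<le>o |?W|"
      using card_of_Times_ordLeq_infinite_Field[of "|?W|"] inf
      by (simp add: Field_card_of card_of_card_order_on)
    then show "|C b a| \<le>o |?W|"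
      unfolding C_def by (rule ordLeq_transitive[OF card_of_image])
  qed
  finally show ?thesis .
qed

text \<open>Packs a small set of coded parameters and a number into a single code, as the recursive
  coding of tree points demands.\<close>

lemma small_set_code:
  fixes \<kappa> :: "'k rel"
  assumes \<kappa>: "Cinfinite \<kappa>" "regularCard \<kappa>"
  defines "W \<equiv> bounded_subsets \<kappa>"
  shows "\<exists>J :: ('k set \<times> nat) set \<times> nat \<Rightarrow> 'k set.
    inj_on J ({Z. Z \<subseteq> W \<times> UNIV \<and> |Z| <o \<kappa>} \<times> UNIV) \<and> J ` ({Z. Z \<subseteq> W \<times> UNIV \<and> |Z| <o \<kappa>} \<times> UNIV) \<subseteq> W"
proof -
  let ?S = "{Z. Z \<subseteq> W \<times> (UNIV :: nat set) \<and> |Z| <o \<kappa>}"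
  have inf: "infinite W" unfolding W_def by (rule infinite_bounded_subsets[OF \<kappa>(1)])
  then have fW: "infinite (Field |W| )" by (simp add: Field_card_of)
  have nat: "|UNIV :: nat set| \<le>o |W|" using inf infinite_iff_card_of_nat by blast
  have times: "|A \<times> (UNIV :: nat set)| \<le>o |W|" if "|A| \<le>o |W|" for A :: "'z set"
    by (rule card_of_Times_ordLeq_infinite_Field[OF fW that nat card_of_Card_order])
  have "|W \<times> (UNIV :: nat set)| \<le>o |W|"
    by (rule times[OF card_of_mono1[OF subset_refl]])
  then obtain g where g: "inj_on g (W \<times> (UNIV :: nat set))" "g ` (W \<times> UNIV) \<subseteq> W"
    by (meson card_of_ordLeq)
  have "inj_on (image g) ?S"
    using inj_on_subset[OF inj_on_image_Pow[OF g(1)], of ?S] by auto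
  moreover have "image g ` ?S \<subseteq> {Z. Z \<subseteq> W \<and> |Z| <o \<kappa>}"
    using g(2) small_image by blast
  ultimately have "|?S| \<le>o |{Z. Z \<subseteq> W \<and> |Z| <o \<kappa>}|"
    by (meson card_of_ordLeq)
  then have "|?S| \<le>o |W|"
    using card_small_sets_le_bounded_subsets[OF \<kappa>] ordLeq_transitive unfolding W_def by blast
  then have "|?S \<times> (UNIV :: nat set)| \<le>o |W|" by (rule times)
  then show ?thesis by (meson card_of_ordLeq)
qed

section \<open>The well-order on an ordinal sum\<close>

lemma Field_ord_plus: "Field (ord_plus \<alpha> \<beta>) = Inl ` Field \<alpha> \<union> Inr ` Field \<beta>"
proof
  show "Field (ord_plus \<alpha> \<beta>) \<subseteq> Inl ` Field \<alpha> \<union> Inr ` Field \<beta>"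
    unfolding ord_plus_def Field_def by auto
  have "Inl x \<in> Field (ord_plus \<alpha> \<beta>)" if "x \<in> Field \<alpha>" for x
  proof -
    have "\<exists>y. (x, y) \<in> \<alpha> \<or> (y, x) \<in> \<alpha>" using that unfolding Field_def by blast
    then obtain y where "(x, y) \<in> \<alpha> \<or> (y, x) \<in> \<alpha>" by blast
    then have "(Inl x, Inl y) \<in> ord_plus \<alpha> \<beta> \<or> (Inl y, Inl x) \<in> ord_plus \<alpha> \<beta>"
      unfolding ord_plus_def by blast
    then show ?thesis by (blast intro: FieldI1 FieldI2)
  qed
  moreover have "Inr x \<in> Field (ord_plus \<alpha> \<beta>)" if "x \<in> Field \<beta>" for x
  proof -
    have "\<exists>y. (x, y) \<in> \<beta> \<or> (y, x) \<in> \<beta>" using that unfolding Field_def by blast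
    then obtain y where "(x, y) \<in> \<beta> \<or> (y, x) \<in> \<beta>" by blast
    then have "(Inr x, Inr y) \<in> ord_plus \<alpha> \<beta> \<or> (Inr y, Inr x) \<in> ord_plus \<alpha> \<beta>"
      unfolding ord_plus_def by blast
    then show ?thesis by (blast intro: FieldI1 FieldI2)
  qed
  ultimately show "Inl ` Field \<alpha> \<union> Inr ` Field \<beta> \<subseteq> Field (ord_plus \<alpha> \<beta>)" by blast
qed

lemma Well_order_ord_plus:
  assumes a: "Well_order \<alpha>" and b: "Well_order \<beta>"
  shows "Well_order (ord_plus \<alpha> \<beta>)"
proof -
  let ?r = "ord_plus \<alpha> \<beta>"
  have A: "Refl \<alpha>" "trans \<alpha>" "antisym \<alpha>" "Total \<alpha>" "wf (\<alpha> - Id)"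
    and B: "Refl \<beta>" "trans \<beta>" "antisym \<beta>" "Total \<beta>" "wf (\<beta> - Id)"
    using a b unfolding order_on_defs by auto
  have simps: "(Inl x, Inl y) \<in> ?r \<longleftrightarrow> (x, y) \<in> \<alpha>" "(Inr u, Inr v) \<in> ?r \<longleftrightarrow> (u, v) \<in> \<beta>"
    "(Inl x, Inr v) \<in> ?r \<longleftrightarrow> x \<in> Field \<alpha> \<and> v \<in> Field \<beta>" "(Inr u, Inl y) \<notin> ?r" for x y u v
    unfolding ord_plus_def by auto
  note F = Field_ord_plus[of \<alpha> \<beta>]
  have "Refl ?r"
    using A(1) B(1) unfolding refl_on_def F by (auto simp: simps)
  moreover have "trans ?r"
  proof (rule transI)
    fix x y z assume "(x, y) \<in> ?r" "(y, z) \<in> ?r"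
    then show "(x, z) \<in> ?r"
      using transD[OF A(2)] transD[OF B(2)]
      by (cases x; cases y; cases z) (auto simp: simps intro: FieldI1 FieldI2)
  qed
  moreover have "antisym ?r"
  proof (rule antisymI)
    fix x y assume "(x, y) \<in> ?r" "(y, x) \<in> ?r"
    then show "x = y"
      using antisymD[OF A(3)] antisymD[OF B(3)] by (cases x; cases y) (auto simp: simps)
  qed
  moreover have "Total ?r"
    unfolding total_on_def
  proof (intro ballI impI)
    fix x y assume "x \<in> Field ?r" "y \<in> Field ?r" "x \<noteq> y"
    then show "(x, y) \<in> ?r \<or> (y, x) \<in> ?r"
      using A(4) B(4) unfolding total_on_def by (cases x; cases y) (auto simp: simps F)
  qed
  moreover have "wf (?r - Id)"
  proof (rule wfI_min)
    fix x Q assume "x \<in> (Q :: ('a + 'b) set)"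
    show "\<exists>z\<in>Q. \<forall>y. (y, z) \<in> ?r - Id \<longrightarrow> y \<notin> Q"
    proof (cases "\<exists>u. Inl u \<in> Q")
      case True
      then obtain u where "u \<in> {u. Inl u \<in> Q}" by blast
      from A(5)[unfolded wf_eq_minimal, rule_format, OF this]
      obtain m where "m \<in> {u. Inl u \<in> Q}" "\<forall>y. (y, m) \<in> \<alpha> - Id \<longrightarrow> y \<notin> {u. Inl u \<in> Q}"
        by blast
      then have m: "Inl m \<in> Q" "\<And>y. (y, m) \<in> \<alpha> - Id \<Longrightarrow> Inl y \<notin> Q" by auto
      have "y \<notin> Q" if "(y, Inl m) \<in> ?r - Id" for y
        using m(2) that by (cases y) (auto simp: simps)
      then show ?thesis using m(1) by blast
    next
      case False
      then obtain u where "Inr u \<in> Q" using \<open>x \<in> Q\<close> by (cases x) auto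
      then obtain u where "u \<in> {u. Inr u \<in> Q}" by blast
      from B(5)[unfolded wf_eq_minimal, rule_format, OF this]
      obtain m where "m \<in> {u. Inr u \<in> Q}" "\<forall>y. (y, m) \<in> \<beta> - Id \<longrightarrow> y \<notin> {u. Inr u \<in> Q}"
        by blast
      then have m: "Inr m \<in> Q" "\<And>y. (y, m) \<in> \<beta> - Id \<Longrightarrow> Inr y \<notin> Q" by auto
      have "y \<notin> Q" if "(y, Inr m) \<in> ?r - Id" for y
        using m(2) False that by (cases y) (auto simp: simps)
      then show ?thesis using m(1) by blast
    qed
  qed
  ultimately show ?thesis
    unfolding order_on_defs by (auto intro: FieldI1 FieldI2)
qed

section \<open>Positive sets in a coloured tree\<close>

definition homog :: "'a rel \<Rightarrow> ('a \<Rightarrow> 'a \<Rightarrow> nat) \<Rightarrow> nat \<Rightarrow> 'i rel \<Rightarrow> ('i \<Rightarrow> 'a) \<Rightarrow> bool" where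
  "homog R col j r h \<longleftrightarrow> (\<forall>a b. (a, b) \<in> r \<and> a \<noteq> b \<longrightarrow> (h a, h b) \<in> R \<and> col (h a) (h b) = j)"

locale coloured_tree =
  fixes R :: "'a rel" and col :: "'a \<Rightarrow> 'a \<Rightarrow> nat" and \<kappa> :: "'k rel"
  assumes wf: "wf R" and trans: "trans R"
    and below_linear: "(x, t) \<in> R \<Longrightarrow> (y, t) \<in> R \<Longrightarrow> x = y \<or> (x, y) \<in> R \<or> (y, x) \<in> R"
    and Cinfinite: "Cinfinite \<kappa>" and regular: "regularCard \<kappa>"
begin

text \<open>
  The sets \<open>cone F D\<close> containing \<open>t\<close>, for \<open>|D| < \<kappa>\<close>, replace the sets containing \<open>t\<close> in an elementary
  submodel that is closed under sequences of length less than \<open>\<kappa>\<close> and generated by the points below \<open>t\<close>.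
  The family \<open>F\<close> lists the sets that the submodel has to know.
\<close>

definition cone :: "('a \<Rightarrow> nat \<Rightarrow> 'a set) \<Rightarrow> ('a \<times> nat) set \<Rightarrow> 'a set" where
  "cone F D = {z. \<forall>(y, e)\<in>D. (y, z) \<in> R \<and> z \<in> F y e}"

text \<open>For one colour \<open>i\<close>, the points of \<open>X\<close> joined to
  \<open>t\<close> by \<open>i\<close> meet every small cone around \<open>t\<close> below
  \<open>t\<close>, a form of stationarity. Longer sequences repeat the demand at the reflecting
  point \<open>a\<close>, keeping only the points of \<open>X\<close> that have colour
  \<open>i\<close> with \<open>t\<close>.\<close>

primrec pos :: "('a \<Rightarrow> nat \<Rightarrow> 'a set) \<Rightarrow> nat list \<Rightarrow> 'a \<Rightarrow> 'a set \<Rightarrow> bool" where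
  "pos F [] t X \<longleftrightarrow> t \<in> X"
| "pos F (i # \<sigma>) t X \<longleftrightarrow> (\<forall>D. |D| <o \<kappa> \<and> t \<in> cone F D \<longrightarrow>
     (\<exists>a. (a, t) \<in> R \<and> a \<in> cone F D \<and> pos F \<sigma> a (X \<inter> {y. col y t = i})))"

lemma pos_ConsI:
  assumes "\<And>D. |D| <o \<kappa> \<Longrightarrow> t \<in> cone F D \<Longrightarrow>
    \<exists>a. (a, t) \<in> R \<and> a \<in> cone F D \<and> pos F \<sigma> a (X \<inter> {y. col y t = i})"
  shows "pos F (i # \<sigma>) t X"
  using assms by simp

lemma pos_ConsE:
  assumes "pos F (i # \<sigma>) t X" "|D| <o \<kappa>" "t \<in> cone F D"
  obtains a where "(a, t) \<in> R" "a \<in> cone F D" "pos F \<sigma> a (X \<inter> {y. col y t = i})"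
  using assms by auto

declare pos.simps(2) [simp del]

section \<open>Closure properties of positivity\<close>

lemma cone_Un: "cone F (D \<union> D') = cone F D \<inter> cone F D'"
  unfolding cone_def by auto

lemma cone_UN: "cone F (\<Union>i\<in>I. D i) = (\<Inter>i\<in>I. cone F (D i))"
  unfolding cone_def by auto

lemma cone_empty [simp]: "cone F {} = UNIV"
  unfolding cone_def by auto

lemma cone_upward: "a \<in> cone F D \<Longrightarrow> (y, e) \<in> D \<Longrightarrow> (y, a) \<in> R"
  unfolding cone_def by auto

lemmas finite_less = small_finite[OF Cinfinite]

lemma pos_mono: "pos F \<sigma> t X \<Longrightarrow> X \<subseteq> Y \<Longrightarrow> pos F \<sigma> t Y"
proof (induction \<sigma> arbitrary: t X Y)
  case (Cons i \<sigma>)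
  show ?case
  proof (rule pos_ConsI)
    fix D :: "('a \<times> nat) set"
    assume "|D| <o \<kappa>" "t \<in> cone F D"
    then obtain a where a: "(a, t) \<in> R" "a \<in> cone F D" "pos F \<sigma> a (X \<inter> {y. col y t = i})"
      using pos_ConsE[OF Cons.prems(1)] by blast
    then show "\<exists>a. (a, t) \<in> R \<and> a \<in> cone F D \<and> pos F \<sigma> a (Y \<inter> {y. col y t = i})"
      using Cons.IH[OF a(3), of "Y \<inter> {y. col y t = i}"] Cons.prems(2) by blast
  qed
qed auto

text \<open>Any demand \<open>D'\<close> can be merged with \<open>D\<close>, as the union is still
  small. The reflecting point then lies in \<open>cone F D\<close> too, and the induction hypothesis
  applies there.\<close>

lemma pos_cone: "pos F \<sigma> t X \<Longrightarrow> |D| <o \<kappa> \<Longrightarrow> t \<in> cone F D \<Longrightarrow> pos F \<sigma> t (X \<inter> cone F D)"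
proof (induction \<sigma> arbitrary: t X)
  case (Cons i \<sigma>)
  show ?case
  proof (rule pos_ConsI)
    fix D' :: "('a \<times> nat) set"
    assume "|D'| <o \<kappa>" "t \<in> cone F D'"
    then have "|D \<union> D'| <o \<kappa>" "t \<in> cone F (D \<union> D')"
      using Cons.prems small_Un[OF Cinfinite] by (auto simp: cone_Un)
    then obtain a where a: "(a, t) \<in> R" "a \<in> cone F (D \<union> D')" "pos F \<sigma> a (X \<inter> {y. col y t = i})"
      using pos_ConsE[OF Cons.prems(1)] by blast
    have "pos F \<sigma> a (X \<inter> {y. col y t = i} \<inter> cone F D)"
      using Cons.IH[OF a(3)] a(2) Cons.prems(2) by (auto simp: cone_Un)
    then show "\<exists>a. (a, t) \<in> R \<and> a \<in> cone F D' \<and> pos F \<sigma> a (X \<inter> cone F D \<inter> {y. col y t = i})"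
      using a by (auto simp: cone_Un ac_simps)
  qed
qed auto

text \<open>The non-positive sets form a \<kappa>-complete ideal. If every piece fails, regularity
  merges the cones witnessing the failures into one small cone; at a reflecting point for it some
  piece is positive by induction, a contradiction.\<close>

lemma pos_UN: "|I| <o \<kappa> \<Longrightarrow> pos F \<sigma> t (\<Union>i\<in>I. X i) \<Longrightarrow> \<exists>i\<in>I. pos F \<sigma> t (X i)"
proof (induction \<sigma> arbitrary: t X)
  case (Cons c \<sigma>)
  show ?case
  proof (rule ccontr)
    assume "\<not> ?thesis"
    then have "\<forall>i\<in>I. \<exists>D. |D| <o \<kappa> \<and> t \<in> cone F D \<and>
        \<not> (\<exists>a. (a, t) \<in> R \<and> a \<in> cone F D \<and> pos F \<sigma> a (X i \<inter> {y. col y t = c}))"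
      unfolding pos.simps by blast
    then obtain D where D: "\<And>i. i \<in> I \<Longrightarrow> |D i| <o \<kappa>" "\<And>i. i \<in> I \<Longrightarrow> t \<in> cone F (D i)"
      "\<And>i a. i \<in> I \<Longrightarrow> (a, t) \<in> R \<Longrightarrow> a \<in> cone F (D i) \<Longrightarrow> \<not> pos F \<sigma> a (X i \<inter> {y. col y t = c})"
      by metis
    have "|\<Union>i\<in>I. D i| <o \<kappa>"
      using D(1) Cons.prems(1) small_UN[OF Cinfinite regular] by blast
    moreover have "t \<in> cone F (\<Union>i\<in>I. D i)"
      using D(2) by (simp add: cone_UN)
    ultimately obtain a where a: "(a, t) \<in> R" "a \<in> cone F (\<Union>i\<in>I. D i)"
      "pos F \<sigma> a ((\<Union>i\<in>I. X i) \<inter> {y. col y t = c})"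
      using pos_ConsE[OF Cons.prems(2)] by blast
    have "pos F \<sigma> a (\<Union>i\<in>I. X i \<inter> {y. col y t = c})"
      using a(3) by (simp add: Int_UN_distrib2)
    then obtain i where "i \<in> I" "pos F \<sigma> a (X i \<inter> {y. col y t = c})"
      using Cons.IH[OF Cons.prems(1)] by blast
    then show False
      using D(3) a by (auto simp: cone_UN)
  qed
qed auto

lemma pos_nonempty: "pos F \<sigma> t X \<Longrightarrow> X \<noteq> {}"
  \<comment> \<open>A union over the empty index set cannot be positive.\<close>
  using pos_UN[of "{} :: nat set" F \<sigma> t "\<lambda>_. {}"] finite_less by fastforce

lemma pos_below: "pos F \<sigma> t X \<Longrightarrow> pos F \<sigma> t (X \<inter> {y. y = t \<or> (y, t) \<in> R})"
proof (induction \<sigma> arbitrary: t X)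
  case (Cons i \<sigma>)
  show ?case
  proof (rule pos_ConsI)
    fix D :: "('a \<times> nat) set"
    assume "|D| <o \<kappa>" "t \<in> cone F D"
    then obtain a where a: "(a, t) \<in> R" "a \<in> cone F D" "pos F \<sigma> a (X \<inter> {y. col y t = i})"
      using pos_ConsE[OF Cons.prems(1)] by blast
    have "pos F \<sigma> a (X \<inter> {y. y = t \<or> (y, t) \<in> R} \<inter> {y. col y t = i})"
      by (rule pos_mono[OF Cons.IH[OF a(3)]]) (use a(1) trans in \<open>auto dest: transD\<close>)
    then show "\<exists>a. (a, t) \<in> R \<and> a \<in> cone F D \<and> pos F \<sigma> a (X \<inter> {y. y = t \<or> (y, t) \<in> R} \<inter> {y. col y t = i})"
      using a by blast
  qed
qed auto

definition finer :: "('a \<Rightarrow> nat \<Rightarrow> 'a set) \<Rightarrow> ('a \<Rightarrow> nat \<Rightarrow> 'a set) \<Rightarrow> bool" where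
  "finer F F' \<longleftrightarrow> (\<forall>e. \<exists>e'. \<forall>y. F y e = F' y e')"

text \<open>Renumbering turns every cone of \<open>F\<close> into a cone of \<open>F'\<close>, so
  positivity for \<open>F'\<close> meets all demands made for \<open>F\<close>.\<close>

lemma pos_coarser:
  assumes "finer F F'"
  shows "pos F' \<sigma> t X \<Longrightarrow> pos F \<sigma> t X"
proof (induction \<sigma> arbitrary: t X)
  case (Cons i \<sigma>)
  obtain \<phi> where \<phi>: "\<And>e y. F y e = F' y (\<phi> e)"
    using assms unfolding finer_def by metis
  show ?case
  proof (rule pos_ConsI)
    fix D :: "('a \<times> nat) set"
    assume D: "|D| <o \<kappa>" "t \<in> cone F D"
    let ?D = "map_prod id \<phi> ` D"
    have eq: "cone F' ?D = cone F D"
      unfolding cone_def by (auto simp: \<phi>)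
    obtain a where "(a, t) \<in> R" "a \<in> cone F' ?D" "pos F' \<sigma> a (X \<inter> {y. col y t = i})"
      using pos_ConsE[OF Cons.prems, of ?D] D small_image eq by metis
    then show "\<exists>a. (a, t) \<in> R \<and> a \<in> cone F D \<and> pos F \<sigma> a (X \<inter> {y. col y t = i})"
      using Cons.IH eq by blast
  qed
qed auto

section \<open>Homogeneous chains inside positive sets\<close>

definition knows_col :: "nat \<Rightarrow> ('a \<Rightarrow> nat \<Rightarrow> 'a set) \<Rightarrow> bool" where
  "knows_col k F \<longleftrightarrow> (\<forall>i<k. \<exists>e. \<forall>y. F y e = {z. col y z = i})"

lemma knows_col_finer:
  assumes "finer F F'" "knows_col k F"
  shows "knows_col k F'"
  unfolding knows_col_def
proof (intro allI impI)
  fix i assume "i < k"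
  then obtain e where "\<forall>y. F y e = {z. col y z = i}"
    using assms(2) unfolding knows_col_def by blast
  moreover obtain e' where "\<forall>y. F y e = F' y e'"
    using assms(1) unfolding finer_def by blast
  ultimately have "\<forall>y. F' y e' = {z. col y z = i}" by simp
  then show "\<exists>e. \<forall>y. F' y e = {z. col y z = i}" ..
qed

text \<open>Recursion along \<open>r\<close>. The earlier blocks have fewer than \<kappa> points in
  all, each joined to \<open>t\<close> by colour \<open>i\<close>, so \<open>t\<close> lies in the
  small cone of points above them all in colour \<open>i\<close>. Positivity reflects this cone to
  some \<open>a\<close> where the rest of \<open>X\<close> is \<open>\<sigma>\<close>-positive, and
  there \<open>Q\<close> supplies the next block.\<close>

lemma pos_block:
  assumes pos: "pos F (i # \<sigma>) t X" and col: "knows_col k F" "i < k"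
    and r: "Well_order r" "\<And>a. a \<in> Field r \<Longrightarrow> |underS r a| <o \<kappa>"
    and Q: "\<And>a Y. pos F \<sigma> a Y \<Longrightarrow> \<exists>B\<subseteq>Y. |B| <o \<kappa> \<and> Q B"
  shows "\<exists>Bf. (\<forall>a\<in>Field r. Bf a \<subseteq> X \<and> Q (Bf a)) \<and>
    (\<forall>a b. (a, b) \<in> r \<and> a \<noteq> b \<longrightarrow> (\<forall>x\<in>Bf a. \<forall>y\<in>Bf b. (x, y) \<in> R \<and> col x y = i))"
proof -
  define Z where "Z = X \<inter> {y. (y, t) \<in> R \<and> col y t = i}"
  obtain e where e: "\<And>y. F y e = {z. col y z = i}"
    using col unfolding knows_col_def by blast
  have step: "\<exists>B\<subseteq>Z. |B| <o \<kappa> \<and> Q B \<and> (\<forall>x\<in>S. \<forall>y\<in>B. (x, y) \<in> R \<and> col x y = i)"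
    if S: "S \<subseteq> Z" "|S| <o \<kappa>" for S
  proof -
    let ?D = "(\<lambda>x. (x, e)) ` S"
    have cone: "cone F ?D = {z. \<forall>x\<in>S. (x, z) \<in> R \<and> col x z = i}"
      unfolding cone_def by (auto simp: e)
    have "t \<in> cone F ?D"
      unfolding cone using S by (auto simp: Z_def)
    moreover have D: "|?D| <o \<kappa>" by (rule small_image[OF S(2)])
    ultimately obtain a where a: "(a, t) \<in> R" "a \<in> cone F ?D" "pos F \<sigma> a (X \<inter> {y. col y t = i})"
      using pos_ConsE[OF pos] by blast
    \<comment> \<open>Restricting to points up to \<open>a\<close> keeps the new block strictly
      below \<open>t\<close>, hence inside \<open>Z\<close>, as later stages require.\<close>
    have "pos F \<sigma> a (X \<inter> {y. col y t = i} \<inter> cone F ?D \<inter> {y. y = a \<or> (y, a) \<in> R})"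
      by (rule pos_below[OF pos_cone[OF a(3) D a(2)]])
    from Q[OF this] obtain B where
      B: "B \<subseteq> X \<inter> {y. col y t = i} \<inter> cone F ?D \<inter> {y. y = a \<or> (y, a) \<in> R}" "|B| <o \<kappa>" "Q B"
      by blast
    moreover have "B \<subseteq> Z"
      using B(1) a(1) trans unfolding Z_def by (auto dest: transD)
    ultimately show ?thesis
      unfolding cone by blast
  qed
  define \<Phi> where "\<Phi> f a B \<longleftrightarrow> (a \<in> Field r \<longrightarrow> B \<subseteq> Z \<and> |B| <o \<kappa> \<and> Q B \<and>
     (\<forall>x\<in>(\<Union>b\<in>underS r a. f b). \<forall>y\<in>B. (x, y) \<in> R \<and> col x y = i))" for f :: "'b \<Rightarrow> 'a set" and a B
  have "\<exists>f. \<forall>a. \<Phi> f a (f a)"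
  proof (rule dependent_wf_choice[OF wf_strict_part[OF r(1)]])
    show "\<Phi> f x B = \<Phi> g x B" if "\<And>z. (z, x) \<in> r - Id \<Longrightarrow> f z = g z" for f g x B
    proof -
      have "(\<Union>b\<in>underS r x. f b) = (\<Union>b\<in>underS r x. g b)"
        using that by (auto simp: underS_def)
      then show ?thesis unfolding \<Phi>_def by simp
    qed
    show "\<exists>B. \<Phi> f x B" if IH: "\<And>y. (y, x) \<in> r - Id \<Longrightarrow> \<Phi> f y (f y)" for f x
    proof (cases "x \<in> Field r")
      case True
      have "f b \<subseteq> Z \<and> |f b| <o \<kappa>" if "b \<in> underS r x" for b
        using IH[of b] that unfolding \<Phi>_def underS_def by (auto intro: FieldI1)
      then have "(\<Union>b\<in>underS r x. f b) \<subseteq> Z" "|\<Union>b\<in>underS r x. f b| <o \<kappa>"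
        using small_UN[OF Cinfinite regular r(2)[OF True]] by blast+
      from step[OF this] show ?thesis unfolding \<Phi>_def by blast
    qed (simp add: \<Phi>_def)
  qed
  then obtain f where f: "\<And>a. \<Phi> f a (f a)" by blast
  show ?thesis
  proof (intro exI conjI ballI allI impI)
    show "f a \<subseteq> X" "Q (f a)" if "a \<in> Field r" for a
      using f[of a] that unfolding \<Phi>_def Z_def by auto
    show "(x, y) \<in> R" "col x y = i" if "(a, b) \<in> r \<and> a \<noteq> b" "x \<in> f a" "y \<in> f b" for a b x y
    proof -
      have "b \<in> Field r" "a \<in> underS r b" using that by (auto simp: underS_def FieldI2)
      then show "(x, y) \<in> R" "col x y = i" using f[of b] that unfolding \<Phi>_def by blast+
    qed
  qed
qed

lemma Well_order: "Well_order \<kappa>"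
  using Cinfinite card_order_on_well_order_on by auto

text \<open>One descends the sequence to the first occurrence of \<open>j\<close>. There
  \<open>pos_block\<close> is run along \<kappa> with nonempty blocks, and one point is taken from
  each.\<close>

lemma pos_homog_kappa:
  assumes "pos F \<sigma> t X" "knows_col k F" "set \<sigma> \<subseteq> {..<k}" "j \<in> set \<sigma>"
  obtains h where "\<And>a. a \<in> Field \<kappa> \<Longrightarrow> h a \<in> X" "homog R col j \<kappa> h"
  using assms
proof (induction \<sigma> arbitrary: t X thesis)
  case (Cons i \<sigma>)
  show ?case
  proof (cases "j = i")
    case True
    have "\<exists>B\<subseteq>Y. |B| <o \<kappa> \<and> B \<noteq> {}" if "pos F \<sigma> a Y" for a Y
    proof -
      have "Y \<noteq> {}" by (rule pos_nonempty[OF that])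
      then obtain y where "y \<in> Y" by blast
      then show ?thesis using finite_less[of "{y}"] by blast
    qed
    note ne = this
    have under: "|underS \<kappa> a| <o \<kappa>" if "a \<in> Field \<kappa>" for a
      using card_of_underS[OF conjunct2[OF Cinfinite] that] .
    have "i < k" using Cons.prems(4) by simp
    have "\<exists>Bf. (\<forall>a\<in>Field \<kappa>. Bf a \<subseteq> X \<and> Bf a \<noteq> {}) \<and>
      (\<forall>a b. (a, b) \<in> \<kappa> \<and> a \<noteq> b \<longrightarrow> (\<forall>x\<in>Bf a. \<forall>y\<in>Bf b. (x, y) \<in> R \<and> col x y = i))"
      by (rule pos_block[OF Cons.prems(2,3) \<open>i < k\<close> Well_order]) (fact under, fact ne)
    then obtain Bf where Bf: "\<forall>a\<in>Field \<kappa>. Bf a \<subseteq> X \<and> Bf a \<noteq> {}"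
      "\<forall>a b. (a, b) \<in> \<kappa> \<and> a \<noteq> b \<longrightarrow> (\<forall>x\<in>Bf a. \<forall>y\<in>Bf b. (x, y) \<in> R \<and> col x y = i)"
      by blast
    define h where "h a = (SOME x. x \<in> Bf a)" for a
    have h: "h a \<in> Bf a" if "a \<in> Field \<kappa>" for a
      unfolding h_def using Bf(1) that by (simp add: some_in_eq)
    show ?thesis
    proof (rule Cons.prems(1))
      show "h a \<in> X" if "a \<in> Field \<kappa>" for a using h Bf(1) that by blast
      show "homog R col j \<kappa> h"
        unfolding homog_def using Bf(2) h True by (blast intro: FieldI1 FieldI2)
    qed
  next
    case False
    obtain a where a: "pos F \<sigma> a (X \<inter> {y. col y t = i})"
      using pos_ConsE[OF Cons.prems(2), of "{}"] finite_less[of "{}"] by auto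
    show ?thesis
      by (rule Cons.IH[OF _ a Cons.prems(3)]) (use Cons.prems False in auto)
  qed
qed auto

end

section \<open>Rich sets whose size is controlled by \<open>\<xi>\<close>\<close>

locale coloured_tree_tail = coloured_tree R col \<kappa>
  for R :: "'a rel" and col and \<kappa> :: "'k rel" +
  fixes \<xi> :: "'x rel"
  assumes Well_order_\<xi>: "Well_order \<xi>" and Pow_\<xi>: "|Pow (Field \<xi>)| <o \<kappa>"
begin

text \<open>This size bound survives unions indexed by \<open>\<xi>\<close> and keeps power sets
  below \<kappa>. Finite sets have their own clause: a union indexed by a finite
  \<open>\<xi>\<close> may outgrow \<open>\<xi>\<close>, and singletons must be little even for
  empty \<open>\<xi>\<close>.\<close>

definition little :: "'y set \<Rightarrow> bool" where
  "little B \<longleftrightarrow> finite B \<or> |B| \<le>o |Field \<xi>|"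

lemma little_Pow: "little B \<Longrightarrow> |Pow B| <o \<kappa>"
proof (unfold little_def, elim disjE)
  assume "|B| \<le>o |Field \<xi>|"
  then have "|Pow B| \<le>o |Pow (Field \<xi>)|" by (rule card_of_Pow_ordLeq)
  then show ?thesis using Pow_\<xi> by (rule ordLeq_ordLess_trans)
qed (simp add: finite_less)

lemma little_less: "little B \<Longrightarrow> |B| <o \<kappa>"
  using little_Pow ordLess_transitive[OF card_of_Pow] by blast

lemma little_UN:
  assumes "\<And>a. a \<in> Field \<xi> \<Longrightarrow> little (B a)"
  shows "little (\<Union>a\<in>Field \<xi>. B a)"
proof (cases "finite (Field \<xi>)")
  case True
  have "finite (B a)" if "a \<in> Field \<xi>" for a
    using assms[OF that] True card_of_ordLeq_finite unfolding little_def by blast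
  then show ?thesis using True unfolding little_def by auto
next
  case False
  have "|B a| \<le>o |Field \<xi>|" if "a \<in> Field \<xi>" for a
    using assms[OF that] False unfolding little_def
    by (metis card_of_Well_order finite_ordLess_infinite Field_card_of ordLess_imp_ordLeq)
  then show ?thesis
    using card_of_UNION_ordLeq_infinite[OF False, of "Field \<xi>" B] card_of_mono1[OF subset_refl]
    unfolding little_def by blast
qed

lemma little_Times_finite:
  assumes "little B" "finite C"
  shows "little (B \<times> C)"
proof (cases "finite B")
  case False
  then have B: "|B| \<le>o |Field \<xi>|" "infinite (Field \<xi>)"
    using assms(1) card_of_ordLeq_finite unfolding little_def by auto
  have "|C| \<le>o |Field \<xi>|"
    using assms(2) B(2) by (metis card_of_Well_order finite_ordLess_infinite Field_card_of ordLess_imp_ordLeq)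
  then show ?thesis
    unfolding little_def
    using card_of_Times_ordLeq_infinite_Field[OF _ B(1) \<open>|C| \<le>o |Field \<xi>|\<close> card_of_Card_order] B(2)
    by (simp add: Field_card_of)
qed (use assms in \<open>simp add: little_def\<close>)

text \<open>
  \<open>B\<close> is a lexicographic power of \<open>\<xi>\<close> in which two points that split at level \<open>l\<close> get the \<open>l\<close>-th colour
  of \<open>\<sigma>\<close>. Either \<open>g\<close> avoids the first colour on some block, or one point of this colour can be picked
  from each block.
\<close>

lemma pos_rich:
  assumes "pos F \<sigma> t X" "knows_col k F" "set \<sigma> \<subseteq> {..<k}"
  shows "\<exists>B\<subseteq>X. little B \<and> (\<forall>g. (\<forall>b\<in>B. g b \<in> set \<sigma>) \<longrightarrow>
    (\<exists>j\<in>set \<sigma>. \<exists>h. (\<forall>a\<in>Field \<xi>. h a \<in> B \<and> g (h a) = j) \<and> homog R col j \<xi> h))"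
  using assms
proof (induction \<sigma> arbitrary: t X)
  case Nil
  \<comment> \<open>With no colour available the requirement on \<open>{t}\<close> is vacuous:
    \<open>g t\<close> would have to lie in the empty set.\<close>
  then show ?case by (intro exI[of _ "{t}"]) (auto simp: little_def)
next
  case (Cons i \<sigma>)
  define Q where "Q B \<longleftrightarrow> little B \<and> (\<forall>g. (\<forall>b\<in>B. g b \<in> set \<sigma>) \<longrightarrow>
    (\<exists>j\<in>set \<sigma>. \<exists>h. (\<forall>a\<in>Field \<xi>. h a \<in> B \<and> g (h a) = j) \<and> homog R col j \<xi> h))" for B
  have Q: "\<exists>B\<subseteq>Y. |B| <o \<kappa> \<and> Q B" if "pos F \<sigma> a Y" for a Y
    using Cons.IH[OF that] Cons.prems little_less unfolding Q_def by auto
  have under: "|underS \<xi> a| <o \<kappa>" for a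
  proof -
    have "underS \<xi> a \<subseteq> Field \<xi>" by (auto simp: underS_def intro: FieldI1)
    then have "little (underS \<xi> a)" unfolding little_def by (simp add: card_of_mono1)
    then show ?thesis by (rule little_less)
  qed
  have "i < k" using Cons.prems by simp
  have "\<exists>Bf. (\<forall>a\<in>Field \<xi>. Bf a \<subseteq> X \<and> Q (Bf a)) \<and>
    (\<forall>a b. (a, b) \<in> \<xi> \<and> a \<noteq> b \<longrightarrow> (\<forall>x\<in>Bf a. \<forall>y\<in>Bf b. (x, y) \<in> R \<and> col x y = i))"
    by (rule pos_block[OF Cons.prems(1,2) \<open>i < k\<close> Well_order_\<xi>]) (rule under, fact Q)
  then obtain Bf where Bf: "\<forall>a\<in>Field \<xi>. Bf a \<subseteq> X \<and> Q (Bf a)"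
    "\<forall>a b. (a, b) \<in> \<xi> \<and> a \<noteq> b \<longrightarrow> (\<forall>x\<in>Bf a. \<forall>y\<in>Bf b. (x, y) \<in> R \<and> col x y = i)"
    by blast
  show ?case
  proof (intro exI conjI allI impI)
    let ?B = "\<Union>a\<in>Field \<xi>. Bf a"
    show "?B \<subseteq> X" using Bf(1) by blast
    show "little ?B" using Bf(1) little_UN unfolding Q_def by blast
    fix g assume g: "\<forall>b\<in>?B. g b \<in> set (i # \<sigma>)"
    show "\<exists>j\<in>set (i # \<sigma>). \<exists>h. (\<forall>a\<in>Field \<xi>. h a \<in> ?B \<and> g (h a) = j) \<and> homog R col j \<xi> h"
    proof (cases "\<exists>a\<in>Field \<xi>. \<forall>b\<in>Bf a. g b \<in> set \<sigma>")
      case True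
      then obtain a where a: "a \<in> Field \<xi>" "\<forall>b\<in>Bf a. g b \<in> set \<sigma>" by blast
      then obtain j h where "j \<in> set \<sigma>" "\<forall>c\<in>Field \<xi>. h c \<in> Bf a \<and> g (h c) = j" "homog R col j \<xi> h"
        using Bf(1) a unfolding Q_def by blast
      with a(1) show ?thesis by (intro bexI[of _ j] exI[of _ h]) auto
    next
      case False
      then have "\<forall>a\<in>Field \<xi>. \<exists>b. b \<in> Bf a \<and> g b = i"
        using g by fastforce
      then obtain h where "\<forall>a\<in>Field \<xi>. h a \<in> Bf a \<and> g (h a) = i"
        by metis
      moreover from this have "homog R col i \<xi> h"
        unfolding homog_def using Bf(2) by (blast intro: FieldI1 FieldI2)
      ultimately show ?thesis by (intro bexI[of _ i] exI[of _ h]) auto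
    qed
  qed
qed

end

context coloured_tree
begin

section \<open>Negligible sets\<close>

text \<open>
  Negligible sets play the role of nonstationary sets. The points of cofinality less than \<open>\<kappa>\<close> are
  negligible as well, since they are determined by a cofinal set of predecessors.
\<close>

definition separates :: "('a \<Rightarrow> ('a \<times> nat) set) \<Rightarrow> ('a \<Rightarrow> nat) \<Rightarrow> 'a set \<Rightarrow> bool" where
  "separates D e B \<longleftrightarrow> (\<forall>t\<in>B. |D t| <o \<kappa> \<and> D t \<subseteq> {y. (y, t) \<in> R} \<times> UNIV) \<and>
     (\<forall>s\<in>B. \<forall>t\<in>B. (s, t) \<in> R \<longrightarrow> D s = D t \<longrightarrow> e s \<noteq> e t)"

definition negligible :: "'a set \<Rightarrow> bool" where
  "negligible B \<longleftrightarrow> (\<exists>D e. separates D e B)"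

lemma separatesI:
  assumes "\<And>t. t \<in> B \<Longrightarrow> |D t| <o \<kappa>" "\<And>t y i. t \<in> B \<Longrightarrow> (y, i) \<in> D t \<Longrightarrow> (y, t) \<in> R"
    and "\<And>s t. s \<in> B \<Longrightarrow> t \<in> B \<Longrightarrow> (s, t) \<in> R \<Longrightarrow> D s = D t \<Longrightarrow> e s \<noteq> e t"
  shows "separates D e B"
  unfolding separates_def
proof (intro conjI ballI impI subsetI)
  show "p \<in> {y. (y, t) \<in> R} \<times> UNIV" if "t \<in> B" "p \<in> D t" for t p
    using assms(2)[of t "fst p" "snd p"] that by (cases p) auto
qed (use assms in auto)

lemma separatesD:
  assumes "separates D e B"
  shows "t \<in> B \<Longrightarrow> |D t| <o \<kappa>" "t \<in> B \<Longrightarrow> (y, i) \<in> D t \<Longrightarrow> (y, t) \<in> R"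
    and "s \<in> B \<Longrightarrow> t \<in> B \<Longrightarrow> (s, t) \<in> R \<Longrightarrow> D s = D t \<Longrightarrow> e s \<noteq> e t"
proof -
  show "|D t| <o \<kappa>" if "t \<in> B"
    using assms that unfolding separates_def by simp
  show "(y, t) \<in> R" if "t \<in> B" "(y, i) \<in> D t"
  proof -
    have "D t \<subseteq> {y. (y, t) \<in> R} \<times> UNIV"
      using assms that(1) unfolding separates_def by simp
    from subsetD[OF this that(2)] show ?thesis by simp
  qed
  show "e s \<noteq> e t" if "s \<in> B" "t \<in> B" "(s, t) \<in> R" "D s = D t"
    using assms that unfolding separates_def by simp
qed

lemma negligible_subset: "negligible B \<Longrightarrow> A \<subseteq> B \<Longrightarrow> negligible A"
proof -
  assume "negligible B" "A \<subseteq> B"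
  then obtain D e where "separates D e B" unfolding negligible_def by blast
  note D = separatesD[OF this]
  have "separates D e A"
  proof (rule separatesI)
    show "|D t| <o \<kappa>" if "t \<in> A" for t
      by (rule D(1)[OF subsetD[OF \<open>A \<subseteq> B\<close> that]])
    show "(y, t) \<in> R" if "t \<in> A" "(y, i) \<in> D t" for t y i
      by (rule D(2)[OF subsetD[OF \<open>A \<subseteq> B\<close> that(1)] that(2)])
    show "e s \<noteq> e t" if "s \<in> A" "t \<in> A" "(s, t) \<in> R" "D s = D t" for s t
      by (rule D(3)[OF subsetD[OF \<open>A \<subseteq> B\<close> that(1)] subsetD[OF \<open>A \<subseteq> B\<close> that(2)] that(3,4)])
  qed
  then show ?thesis unfolding negligible_def by blast
qed

text \<open>The number attached to \<open>t\<close> also records the least index \<open>m t\<close>,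
  so comparable points with equal data would already clash within one \<open>A n\<close>.\<close>

lemma negligible_UN:
  fixes A :: "nat \<Rightarrow> 'a set"
  assumes "\<And>n. negligible (A n)"
  shows "negligible (\<Union>n. A n)"
proof -
  obtain D e where "\<And>n. separates (D n) (e n) (A n)"
    using assms unfolding negligible_def by metis
  note D = separatesD[OF this]
  define m where "m t = (LEAST n. t \<in> A n)" for t
  have m: "t \<in> A (m t)" if "t \<in> (\<Union>n. A n)" for t
    using that unfolding m_def by (auto intro: LeastI)
  have "separates (\<lambda>t. D (m t) t) (\<lambda>t. prod_encode (m t, e (m t) t)) (\<Union>n. A n)"
  proof (rule separatesI)
    show "|D (m t) t| <o \<kappa>" if "t \<in> (\<Union>n. A n)" for t
      using D(1) m[OF that] by blast
    show "(y, t) \<in> R" if "t \<in> (\<Union>n. A n)" "(y, i) \<in> D (m t) t" for t y i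
      by (rule D(2)[OF m[OF that(1)] that(2)])
    show "prod_encode (m s, e (m s) s) \<noteq> prod_encode (m t, e (m t) t)"
      if st: "s \<in> (\<Union>n. A n)" "t \<in> (\<Union>n. A n)" "(s, t) \<in> R" "D (m s) s = D (m t) t" for s t
    proof
      assume "prod_encode (m s, e (m s) s) = prod_encode (m t, e (m t) t)"
      then have "m s = m t" "e (m t) s = e (m t) t" by auto
      with D(3)[of s "m t" t] m[OF st(1)] m[OF st(2)] st show False by auto
    qed
  qed
  then show ?thesis unfolding negligible_def by blast
qed

text \<open>A pressing-down argument: if s below t in \<open>B\<close> had \<open>D s = D t\<close>,
  then s, lying in its own cone, would lie in that of t, contrary to the choice of
  \<open>D t\<close>. The number can therefore be constant.\<close>

lemma negligible_no_reflection:
  assumes "\<And>t. t \<in> B \<Longrightarrow> \<exists>D. |D| <o \<kappa> \<and> t \<in> cone F D \<and> (\<forall>s. (s, t) \<in> R \<and> s \<in> cone F D \<longrightarrow> s \<notin> B)"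
  shows "negligible B"
proof -
  obtain D where D: "\<And>t. t \<in> B \<Longrightarrow> |D t| <o \<kappa>" "\<And>t. t \<in> B \<Longrightarrow> t \<in> cone F (D t)"
    "\<And>s t. t \<in> B \<Longrightarrow> (s, t) \<in> R \<Longrightarrow> s \<in> cone F (D t) \<Longrightarrow> s \<notin> B"
    using assms by metis
  have "separates D (\<lambda>_. 0) B"
  proof (rule separatesI)
    show "(y, t) \<in> R" if "t \<in> B" "(y, i) \<in> D t" for t y i
      using cone_upward D(2) that by blast
    show "(\<lambda>_. 0 :: nat) s \<noteq> (\<lambda>_. 0) t" if "s \<in> B" "t \<in> B" "(s, t) \<in> R" "D s = D t" for s t
      using D(2)[OF that(1)] D(3)[OF that(2,3)] that by auto
  qed (rule D(1))
  then show ?thesis unfolding negligible_def by blast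
qed

text \<open>
  The code of \<open>t\<close> is formed hereditarily from the codes of its parameters. Comparable points with equal
  codes have, by induction, the same parameters and hence coincide.
\<close>

lemma negligible_imp_antichain_code:
  fixes J :: "('w \<times> nat) set \<times> nat \<Rightarrow> 'w"
  assumes "negligible UNIV"
    and J: "inj_on J ({Z. Z \<subseteq> W \<times> UNIV \<and> |Z| <o \<kappa>} \<times> UNIV)"
    and JW: "J ` ({Z. Z \<subseteq> W \<times> UNIV \<and> |Z| <o \<kappa>} \<times> UNIV) \<subseteq> W"
  shows "\<exists>f. range f \<subseteq> W \<and> (\<forall>s t. (s, t) \<in> R \<longrightarrow> f s \<noteq> f t)"
proof -
  obtain D e where "separates D e UNIV"
    using assms(1) unfolding negligible_def by blast
  note D = separatesD[OF this, simplified]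
  have "\<exists>f. \<forall>t. f t = J (map_prod f id ` D t, e t)"
  proof (rule dependent_wf_choice[OF wf, where P = "\<lambda>f t c. c = J (map_prod f id ` D t, e t)"])
    show "(c = J (map_prod f id ` D t, e t)) = (c = J (map_prod g id ` D t, e t))"
      if "\<And>s. (s, t) \<in> R \<Longrightarrow> f s = g s" for f g :: "'a \<Rightarrow> 'w" and t c
    proof -
      have "map_prod f id ` D t = map_prod g id ` D t"
        by (rule image_cong) (auto simp: that D(2))
      then show ?thesis by simp
    qed
  qed blast
  then obtain f where f: "\<And>t. f t = J (map_prod f id ` D t, e t)" by blast
  have small: "|map_prod f id ` D t| <o \<kappa>" for t
    by (rule small_image[OF D(1)])
  have fW: "f t \<in> W" for t
  proof (induction t rule: wf_induct_rule[OF wf])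
    case (1 t)
    then have "map_prod f id ` D t \<subseteq> W \<times> UNIV" using D(2) by force
    then have "(map_prod f id ` D t, e t) \<in> {Z. Z \<subseteq> W \<times> UNIV \<and> |Z| <o \<kappa>} \<times> UNIV"
      using small by simp
    then show ?case unfolding f[of t] using JW by blast
  qed
  have inj: "s = t" if "f s = f t" "s = t \<or> (s, t) \<in> R \<or> (t, s) \<in> R" for s t
    using that
  proof (induction t arbitrary: s rule: wf_induct_rule[OF wf])
    case (1 t)
    have "J (map_prod f id ` D s, e s) = J (map_prod f id ` D t, e t)"
      using 1(2) f by metis
    moreover have mem: "(map_prod f id ` D u, e u) \<in> {Z. Z \<subseteq> W \<times> UNIV \<and> |Z| <o \<kappa>} \<times> UNIV" for u
      using fW small by auto
    ultimately have "(map_prod f id ` D s, e s) = (map_prod f id ` D t, e t)"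
      by (intro inj_onD[OF J] mem)
    then have eq: "map_prod f id ` D s = map_prod f id ` D t" "e s = e t" by auto
    \<comment> \<open>As \<open>s\<close> and \<open>t\<close> are equal or comparable,
      \<open>x\<close> and \<open>y\<close> both lie below the larger of the two.\<close>
    have comp: "x = y \<or> (x, y) \<in> R \<or> (y, x) \<in> R" if "(x, s) \<in> R" "(y, t) \<in> R" for x y
      using 1(3) that below_linear transD[OF trans] by metis
    have same: "x = y" if "(x, i) \<in> D s" "(y, i') \<in> D t" "f x = f y" for x y i i'
      using 1(1)[of y x] that D(2) comp by metis
    have "D s = D t"
    proof (intro set_eqI iffI)
      fix p assume "p \<in> D s"
      then obtain x i where p: "p = (x, i)" "(x, i) \<in> D s" by (cases p) auto
      then have "(f x, i) \<in> map_prod f id ` D s" by force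
      then have "(f x, i) \<in> map_prod f id ` D t" unfolding eq(1) .
      then obtain y where "(y, i) \<in> D t" "f x = f y" by auto
      then show "p \<in> D t" using same p by blast
    next
      fix p assume "p \<in> D t"
      then obtain y i where p: "p = (y, i)" "(y, i) \<in> D t" by (cases p) auto
      then have "(f y, i) \<in> map_prod f id ` D t" by force
      then have "(f y, i) \<in> map_prod f id ` D s" unfolding eq(1) .
      then obtain x where "(x, i) \<in> D s" "f x = f y" by auto
      then show "p \<in> D s" using same p by blast
    qed
    then show ?case using D(3) eq(2) 1(3) by metis
  qed
  show ?thesis
  proof (intro exI conjI allI impI)
    show "f s \<noteq> f t" if "(s, t) \<in> R" for s t
      using inj[of s t] that wf_not_refl[OF wf] by blast
  qed (use fW in blast)
qed

end

context coloured_tree_tail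
begin

section \<open>Prolonging sequences of positive colours\<close>

lemma homog_ord_plus:
  assumes "homog R col j \<kappa> h1" "homog R col j \<xi> h2"
    and "\<And>a b. a \<in> Field \<kappa> \<Longrightarrow> b \<in> Field \<xi> \<Longrightarrow> (h1 a, h2 b) \<in> R \<and> col (h1 a) (h2 b) = j"
  shows "homog R col j (ord_plus \<kappa> \<xi>) (case_sum h1 h2)"
  unfolding homog_def
proof (intro allI impI)
  fix a b assume "(a, b) \<in> ord_plus \<kappa> \<xi> \<and> a \<noteq> b"
  then consider x y where "a = Inl x" "b = Inl y" "(x, y) \<in> \<kappa>" "x \<noteq> y"
    | x y where "a = Inr x" "b = Inr y" "(x, y) \<in> \<xi>" "x \<noteq> y"
    | x y where "a = Inl x" "b = Inr y" "x \<in> Field \<kappa>" "y \<in> Field \<xi>"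
    unfolding ord_plus_def by blast
  then show "(case_sum h1 h2 a, case_sum h1 h2 b) \<in> R \<and> col (case_sum h1 h2 a) (case_sum h1 h2 b) = j"
  proof cases
    case 1 then show ?thesis using assms(1) unfolding homog_def by simp
  next
    case 2 then show ?thesis using assms(2) unfolding homog_def by simp
  next
    case 3 then show ?thesis using assms(3) by simp
  qed
qed

text \<open>If no new colour is positive, this failure at \<open>\<beta>\<close> is expressed by a
  set known to \<open>F'\<close>, so there is a rich set \<open>B\<close> all of whose points fail
  likewise. Some type over \<open>B\<close> is positively frequent below \<open>\<alpha>\<close> and
  uses only colours of \<open>\<sigma>\<close>. A \<kappa>-chain of that type followed by a
  \<xi>-chain in \<open>B\<close> contradicts \<open>none\<close>.\<close>

lemma new_colour:
  assumes none: "\<And>j h. \<not> homog R col j (ord_plus \<kappa> \<xi>) h"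
    and col: "\<And>s t. (s, t) \<in> R \<Longrightarrow> col s t < k"
    and F: "knows_col k F" and \<sigma>: "set \<sigma> \<subseteq> {..<k}"
    and finer: "finer F F'"
    and e: "\<And>y. F' y e = {z. \<forall>j<k. j \<notin> set \<sigma> \<longrightarrow> \<not> pos F \<sigma> y {u. col u z = j}}"
    and \<alpha>: "pos F \<sigma> \<alpha> UNIV" and \<beta>: "pos F' \<sigma> \<beta> UNIV" and \<alpha>\<beta>: "(\<alpha>, \<beta>) \<in> R"
  shows "\<exists>j<k. j \<notin> set \<sigma> \<and> pos F \<sigma> \<alpha> {u. col u \<beta> = j}"
proof (rule ccontr)
  assume contr: "\<not> ?thesis"
  have F': "knows_col k F'"
    by (rule knows_col_finer[OF finer F])
  have "pos F' \<sigma> \<beta> (UNIV \<inter> cone F' {(\<alpha>, e)})"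
  proof (rule pos_cone[OF \<beta>])
    show "|{(\<alpha>, e)}| <o \<kappa>" using finite_less by blast
    show "\<beta> \<in> cone F' {(\<alpha>, e)}" using contr \<alpha>\<beta> unfolding cone_def by (auto simp: e)
  qed
  from pos_rich[OF this F' \<sigma>] obtain B where B: "B \<subseteq> cone F' {(\<alpha>, e)}" "little B"
    and rich: "\<And>g. (\<forall>b\<in>B. g b \<in> set \<sigma>) \<Longrightarrow>
      \<exists>j\<in>set \<sigma>. \<exists>h. (\<forall>a\<in>Field \<xi>. h a \<in> B \<and> g (h a) = j) \<and> homog R col j \<xi> h"
    by auto
  have \<alpha>B: "(\<alpha>, b) \<in> R" "\<And>j. j < k \<Longrightarrow> j \<notin> set \<sigma> \<Longrightarrow> \<not> pos F \<sigma> \<alpha> {u. col u b = j}" if "b \<in> B" for b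
    using B(1) that unfolding cone_def by (auto simp: e)
  \<comment> \<open>\<open>G\<close> is the type of \<open>y\<close> over \<open>B\<close>, the
    graph of its colours to \<open>B\<close>. Littleness of \<open>B\<close> leaves fewer than
    \<kappa> types.\<close>
  define X where "X G = {y. (y = \<alpha> \<or> (y, \<alpha>) \<in> R) \<and> (\<lambda>b. (b, col y b)) ` B = G}" for G
  have yB: "(y, b) \<in> R" if "y = \<alpha> \<or> (y, \<alpha>) \<in> R" "b \<in> B" for y b
    using that \<alpha>B(1) transD[OF trans] by metis
  have "pos F \<sigma> \<alpha> (\<Union>G\<in>Pow (B \<times> {..<k}). X G)"
  proof (rule pos_mono[OF pos_below[OF \<alpha>]])
    show "UNIV \<inter> {y. y = \<alpha> \<or> (y, \<alpha>) \<in> R} \<subseteq> (\<Union>G\<in>Pow (B \<times> {..<k}). X G)"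
      unfolding X_def using yB col by auto
  qed
  moreover have "|Pow (B \<times> {..<k})| <o \<kappa>"
    using little_Pow little_Times_finite[OF B(2)] by blast
  ultimately obtain G where G: "pos F \<sigma> \<alpha> (X G)"
    using pos_UN by blast
  obtain y0 where y0: "y0 \<in> X G" using pos_nonempty[OF G] by blast
  have agree: "col y b = col y0 b" if "y \<in> X G" "b \<in> B" for y b
    using that y0 unfolding X_def by (auto simp: image_iff set_eq_iff)
  \<comment> \<open>A colour outside \<open>\<sigma>\<close> at \<open>b\<close> would be shared by
    all of \<open>X G\<close>, hence be positive for \<open>b\<close>, against the choice of
    \<open>B\<close>.\<close>
  have in\<sigma>: "col y0 b \<in> set \<sigma>" if b: "b \<in> B" for b
  proof (rule ccontr)
    assume "col y0 b \<notin> set \<sigma>"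
    moreover have "col y0 b < k" using y0 yB col b unfolding X_def by auto
    moreover have "pos F \<sigma> \<alpha> {u. col u b = col y0 b}"
      by (rule pos_mono[OF G]) (use agree b in auto)
    ultimately show False using \<alpha>B(2)[OF b] by blast
  qed
  then obtain j h2 where j: "j \<in> set \<sigma>" and h2: "\<forall>a\<in>Field \<xi>. h2 a \<in> B \<and> col y0 (h2 a) = j" "homog R col j \<xi> h2"
    using rich[of "col y0"] by blast
  obtain h1 where h1: "\<And>a. a \<in> Field \<kappa> \<Longrightarrow> h1 a \<in> X G" "homog R col j \<kappa> h1"
    using pos_homog_kappa[OF G F \<sigma> j] by blast
  have "homog R col j (ord_plus \<kappa> \<xi>) (case_sum h1 h2)"
  proof (rule homog_ord_plus[OF h1(2) h2(2)])
    fix a b assume ab: "a \<in> Field \<kappa>" "b \<in> Field \<xi>"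
    then have ab': "h1 a \<in> X G" "h2 b \<in> B" "col y0 (h2 b) = j" using h1(1) h2(1) by auto
    have "(h1 a, h2 b) \<in> R"
      by (rule yB[OF _ ab'(2)]) (use ab'(1) in \<open>simp add: X_def\<close>)
    then show "(h1 a, h2 b) \<in> R \<and> col (h1 a) (h2 b) = j"
      using agree[OF ab'(1,2)] ab'(3) by simp
  qed
  with none show False by blast
qed

text \<open>
  The induction quantifies over all families \<open>F\<close>, since the step must pass to a finer family that knows
  the sets defined from positivity with respect to \<open>F\<close>.
\<close>

lemma refined_family:
  fixes F :: "'a \<Rightarrow> nat \<Rightarrow> 'a set" and G :: "nat list \<Rightarrow> 'a \<Rightarrow> 'a set"
  shows "\<exists>F'. finer F F' \<and> (\<forall>\<sigma>. \<exists>e. \<forall>y. F' y e = G \<sigma> y)"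
proof (intro exI conjI allI)
  let ?F' = "\<lambda>y e. case (from_nat e :: nat + nat list) of Inl e \<Rightarrow> F y e | Inr \<sigma> \<Rightarrow> G \<sigma> y"
  show "finer F ?F'"
    unfolding finer_def
  proof
    show "\<exists>e'. \<forall>y. F y e = ?F' y e'" for e
      by (rule exI[of _ "to_nat (Inl e :: nat + nat list)"]) simp
  qed
  show "?F' y (to_nat (Inr \<sigma> :: nat + nat list)) = G \<sigma> y" for \<sigma> y
    by simp
qed

text \<open>Without a homogeneous chain, for every n some n distinct colours below \<open>k\<close>
  form a sequence that is positive on a nonnegligible set of points; this is absurd for n = k +
  1.\<close>

theorem homogeneous_chain:
  assumes nonneg: "\<not> negligible UNIV" and col: "\<And>s t. (s, t) \<in> R \<Longrightarrow> col s t < k"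
  shows "\<exists>j h. homog R col j (ord_plus \<kappa> \<xi>) h"
proof (rule ccontr)
  assume "\<not> ?thesis"
  then have none: "\<And>j h. \<not> homog R col j (ord_plus \<kappa> \<xi>) h" by blast
  have ind: "\<exists>\<sigma> L. length \<sigma> = n \<and> distinct \<sigma> \<and> set \<sigma> \<subseteq> {..<k} \<and> \<not> negligible L \<and> (\<forall>t\<in>L. pos F \<sigma> t UNIV)"
    if "knows_col k F" for n F
    using that
  proof (induction n arbitrary: F)
    case 0
    then show ?case using nonneg by (intro exI[of _ "[]"] exI[of _ UNIV]) auto
  next
    case (Suc n)
    from refined_family[of F "\<lambda>\<sigma> y. {z. \<forall>j<k. j \<notin> set \<sigma> \<longrightarrow> \<not> pos F \<sigma> y {u. col u z = j}}"]
    obtain F' where F': "finer F F' \<and>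
      (\<forall>\<sigma>. \<exists>e. \<forall>y. F' y e = {z. \<forall>j<k. j \<notin> set \<sigma> \<longrightarrow> \<not> pos F \<sigma> y {u. col u z = j}})" ..
    have "knows_col k F'"
      by (rule knows_col_finer[OF conjunct1[OF F'] Suc.prems])
    from Suc.IH[OF this] obtain \<sigma> L where \<sigma>: "length \<sigma> = n" "distinct \<sigma>" "set \<sigma> \<subseteq> {..<k}"
      and L: "\<not> negligible L" "\<And>t. t \<in> L \<Longrightarrow> pos F' \<sigma> t UNIV"
      by blast
    obtain e where e: "\<And>y. F' y e = {z. \<forall>j<k. j \<notin> set \<sigma> \<longrightarrow> \<not> pos F \<sigma> y {u. col u z = j}}"
      using conjunct2[OF F'] by blast
    define A where "A j = {t\<in>L. pos F (j # \<sigma>) t UNIV}" for j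
    define C where "C = {j. j < k \<and> j \<notin> set \<sigma>}"
    have new: "\<exists>j\<in>C. pos F \<sigma> a {u. col u t = j}" if "a \<in> L" "t \<in> L" "(a, t) \<in> R" for a t
      using new_colour[OF none col Suc.prems \<sigma>(3) conjunct1[OF F'] e pos_coarser[OF conjunct1[OF F'] L(2)] L(2)] that
      unfolding C_def by blast
    \<comment> \<open>A point of \<open>L\<close> outside every \<open>A j\<close> has, for each of
      the finitely many \<open>j\<close> in \<open>C\<close>, a small cone refuting
      \<open>j\<close>. A point of \<open>L\<close> below it in all these cones would contradict
      \<open>new\<close>, so reflection fails.\<close>
    have neg: "negligible (L - (\<Union>j\<in>C. A j))"
    proof (rule negligible_no_reflection)
      fix t assume t: "t \<in> L - (\<Union>j\<in>C. A j)"
      have "\<forall>j\<in>C. \<exists>D. |D| <o \<kappa> \<and> t \<in> cone F D \<and>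
          \<not> (\<exists>a. (a, t) \<in> R \<and> a \<in> cone F D \<and> pos F \<sigma> a (UNIV \<inter> {y. col y t = j}))"
        using t unfolding A_def pos.simps by auto
      then obtain D where D: "\<And>j. j \<in> C \<Longrightarrow> |D j| <o \<kappa>" "\<And>j. j \<in> C \<Longrightarrow> t \<in> cone F (D j)"
        "\<And>j a. j \<in> C \<Longrightarrow> (a, t) \<in> R \<Longrightarrow> a \<in> cone F (D j) \<Longrightarrow> \<not> pos F \<sigma> a {y. col y t = j}"
        by (metis inf_top_left)
      have "finite C" unfolding C_def by auto
      then have "|C| <o \<kappa>" by (rule finite_less)
      then have "|\<Union>j\<in>C. D j| <o \<kappa>"
        using D(1) by (rule small_UN[OF Cinfinite regular])
      moreover have "t \<in> cone F (\<Union>j\<in>C. D j)"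
        using D(2) by (simp add: cone_UN)
      moreover have "s \<notin> L" if "(s, t) \<in> R" "s \<in> cone F (\<Union>j\<in>C. D j)" for s
        using new[of s t] t D(3) that by (auto simp: cone_UN)
      ultimately show "\<exists>D. |D| <o \<kappa> \<and> t \<in> cone F D \<and>
          (\<forall>s. (s, t) \<in> R \<and> s \<in> cone F D \<longrightarrow> s \<notin> L - (\<Union>j\<in>C. A j))"
        by blast
    qed
    have "\<exists>j\<in>C. \<not> negligible (A j)"
    proof (rule ccontr)
      assume "\<not> ?thesis"
      then have neg': "negligible (A j)" if "j \<in> C" for j using that by blast
      \<comment> \<open>Slot 0 holds the remainder and slot j + 1 the set for colour j, to fit the
        countable union.\<close>
      define A' where "A' n = (case n of 0 \<Rightarrow> L - (\<Union>j\<in>C. A j) | Suc j \<Rightarrow> if j \<in> C then A j else {})" for n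
      have "negligible (\<Union>n. A' n)"
      proof (rule negligible_UN)
        show "negligible (A' n)" for n
          using neg neg' negligible_subset[OF neg, of "{}"] unfolding A'_def by (auto split: nat.split)
      qed
      moreover have "L \<subseteq> (\<Union>n. A' n)"
      proof
        fix t assume "t \<in> L"
        then have "t \<in> A' 0 \<or> (\<exists>j\<in>C. t \<in> A' (Suc j))"
          unfolding A'_def by auto
        then show "t \<in> (\<Union>n. A' n)" by blast
      qed
      ultimately show False using L(1) negligible_subset by blast
    qed
    then obtain j where j: "j \<in> C" "\<not> negligible (A j)" by blast
    show ?case
    proof (intro exI conjI)
      show "\<not> negligible (A j)" by fact
      show "length (j # \<sigma>) = Suc n" "distinct (j # \<sigma>)" "set (j # \<sigma>) \<subseteq> {..<k}"
        using \<sigma> j(1) unfolding C_def by auto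
      show "\<forall>t\<in>A j. pos F (j # \<sigma>) t UNIV" unfolding A_def by blast
    qed
  qed
  have "knows_col k (\<lambda>y e. {z. col y z = e})"
    unfolding knows_col_def by blast
  from ind[OF this, of "Suc k"] obtain \<sigma> where "length \<sigma> = Suc k" "distinct \<sigma>" "set \<sigma> \<subseteq> {..<k}"
    by blast
  then show False
    using card_mono[of "{..<k}" "set \<sigma>"] distinct_card[of \<sigma>] by simp
qed

end

section \<open>The tree of bounded well-ordered subsets\<close>

text \<open>Since \<open>\<mu>\<close> may be singular, chains of a regular type up to
  \<open>\<mu>\<close> but larger than the initial segment are used: \<open>natLeq\<close> or a
  successor cardinal. The disjunction separates the two because they live on different
  types.\<close>

lemma regular_below:
  fixes \<mu> :: "'l rel"
  assumes "Cinfinite \<mu>" "\<eta> \<in> Field \<mu>"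
  shows "( |underS \<mu> \<eta>| <o natLeq \<and> natLeq \<le>o \<mu>) \<or>
    (Cinfinite (cardSuc |underS \<mu> \<eta>| ) \<and> regularCard (cardSuc |underS \<mu> \<eta>| ) \<and>
     |underS \<mu> \<eta>| <o cardSuc |underS \<mu> \<eta>| \<and> cardSuc |underS \<mu> \<eta>| \<le>o \<mu>)"
proof (cases "finite (underS \<mu> \<eta>)")
  case True
  have "Cinfinite natLeq" by (rule natLeq_Cinfinite)
  then show ?thesis
    using natLeq_ordLeq_cinfinite[OF assms(1)] small_finite[OF _ True] by blast
next
  case False
  have less: "|underS \<mu> \<eta>| <o \<mu>"
    by (rule card_of_underS[OF conjunct2[OF assms(1)] assms(2)])
  have "Cinfinite |underS \<mu> \<eta>|"
    using False by (simp add: cinfinite_def Field_card_of card_of_card_order_on)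
  then show ?thesis
    using Cinfinite_cardSuc regularCard_cardSuc cardSuc_greater[OF card_of_Card_order]
      cardSuc_least[OF card_of_Card_order conjunct2[OF assms(1)] less] by blast
qed

locale poset_chains =
  fixes P :: "'p rel"
  assumes Partial_order: "Partial_order P"
begin

lemma P_refl: "x \<in> Field P \<Longrightarrow> (x, x) \<in> P"
  and P_antisym: "(x, y) \<in> P \<Longrightarrow> (y, x) \<in> P \<Longrightarrow> x = y"
  and P_trans: "(x, y) \<in> P \<Longrightarrow> (y, z) \<in> P \<Longrightarrow> (x, z) \<in> P"
  using Partial_order unfolding order_on_defs refl_on_def antisym_def trans_def by blast+

definition lt :: "'p \<Rightarrow> 'p \<Rightarrow> bool" where
  "lt x y \<longleftrightarrow> (x, y) \<in> P \<and> x \<noteq> y"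

lemma lt_trans: "lt x y \<Longrightarrow> lt y z \<Longrightarrow> lt x z"
  unfolding lt_def using P_trans P_antisym by blast

lemma le_lt_trans: "(x, y) \<in> P \<Longrightarrow> lt y z \<Longrightarrow> lt x z"
  unfolding lt_def using P_trans P_antisym by blast

lemma lt_le_trans: "lt x y \<Longrightarrow> (y, z) \<in> P \<Longrightarrow> lt x z"
  unfolding lt_def using P_trans P_antisym by blast

lemma lt_irrefl: "\<not> lt x x"
  unfolding lt_def by simp

lemma lt_not_le: "lt x y \<Longrightarrow> (y, x) \<notin> P"
  unfolding lt_def using P_antisym by blast

definition wo :: "'p set \<Rightarrow> bool" where
  "wo s \<longleftrightarrow> s \<subseteq> Field P \<and> (\<forall>A\<subseteq>s. A \<noteq> {} \<longrightarrow> (\<exists>m\<in>A. \<forall>x\<in>A. (m, x) \<in> P))"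

definition ext :: "'p set \<Rightarrow> 'p set \<Rightarrow> bool" where
  "ext s t \<longleftrightarrow> s \<subseteq> t \<and> (\<forall>x\<in>t - s. \<forall>y\<in>s. lt y x)"

lemma ext_refl: "ext s s"
  unfolding ext_def by simp

lemma ext_trans: "ext s t \<Longrightarrow> ext t u \<Longrightarrow> ext s u"
  unfolding ext_def by (metis DiffE DiffI subset_eq)

lemma ext_UN: "(\<And>i. i \<in> I \<Longrightarrow> ext (U i) t) \<Longrightarrow> ext (\<Union>i\<in>I. U i) t"
  unfolding ext_def by blast

lemma ext_in_UN:
  assumes lin: "\<And>i j. i \<in> I \<Longrightarrow> j \<in> I \<Longrightarrow> ext (U i) (U j) \<or> ext (U j) (U i)" and "i \<in> I"
  shows "ext (U i) (\<Union>i\<in>I. U i)"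
  unfolding ext_def
proof (intro conjI ballI)
  fix x y assume x: "x \<in> (\<Union>i\<in>I. U i) - U i" and y: "y \<in> U i"
  then obtain j where j: "j \<in> I" "x \<in> U j" by blast
  then have "\<not> ext (U j) (U i)" using x unfolding ext_def by blast
  then have "ext (U i) (U j)" using lin[OF \<open>i \<in> I\<close> j(1)] by blast
  then show "lt y x" using x y j(2) unfolding ext_def by blast
qed (use \<open>i \<in> I\<close> in blast)

lemma wo_UN:
  assumes lin: "\<And>i j. i \<in> I \<Longrightarrow> j \<in> I \<Longrightarrow> ext (U i) (U j) \<or> ext (U j) (U i)"
    and wo: "\<And>i. i \<in> I \<Longrightarrow> wo (U i)"
  shows "wo (\<Union>i\<in>I. U i)"
  unfolding wo_def
proof (intro conjI allI impI)
  show "(\<Union>i\<in>I. U i) \<subseteq> Field P" using wo unfolding wo_def by blast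
  fix A assume A: "A \<subseteq> (\<Union>i\<in>I. U i)" "A \<noteq> {}"
  then obtain i where i: "i \<in> I" "A \<inter> U i \<noteq> {}" by blast
  moreover have "A \<inter> U i \<subseteq> U i" by blast
  ultimately obtain m where m: "m \<in> A \<inter> U i" "\<And>x. x \<in> A \<inter> U i \<Longrightarrow> (m, x) \<in> P"
    using wo[OF i(1)] unfolding wo_def by meson
  have "(m, x) \<in> P" if "x \<in> A" for x
  proof (cases "x \<in> U i")
    case False
    have "ext (U i) (\<Union>i\<in>I. U i)" by (rule ext_in_UN[OF lin i(1)])
    then have "lt m x" using A(1) False m(1) that unfolding ext_def by blast
    then show ?thesis unfolding lt_def by simp
  qed (use m(2) that in blast)
  then show "\<exists>m\<in>A. \<forall>x\<in>A. (m, x) \<in> P" using m(1) by blast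
qed

definition node :: "'p set \<Rightarrow> bool" where
  "node s \<longleftrightarrow> wo s \<and> (\<exists>m\<in>s. \<forall>x\<in>s. (x, m) \<in> P)"

definition top :: "'p set \<Rightarrow> 'p" where
  "top s = (SOME m. m \<in> s \<and> (\<forall>x\<in>s. (x, m) \<in> P))"

lemma top:
  assumes "node s"
  shows "top s \<in> s" "x \<in> s \<Longrightarrow> (x, top s) \<in> P"
proof -
  have "top s \<in> s \<and> (\<forall>x\<in>s. (x, top s) \<in> P)"
    unfolding top_def by (rule someI_ex) (use assms in \<open>auto simp: node_def\<close>)
  then show "top s \<in> s" "x \<in> s \<Longrightarrow> (x, top s) \<in> P" by auto
qed

lemma top_in_Field: "node s \<Longrightarrow> top s \<in> Field P"
  using top(1) unfolding node_def wo_def by blast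

lemma top_eqI: "node s \<Longrightarrow> m \<in> s \<Longrightarrow> (\<And>x. x \<in> s \<Longrightarrow> (x, m) \<in> P) \<Longrightarrow> top s = m"
  using top P_antisym by blast

definition chain_tree :: "'p set rel" where
  "chain_tree = {(s, t). node s \<and> node t \<and> ext s t \<and> s \<noteq> t}"

lemma chain_treeD: "(s, t) \<in> chain_tree \<Longrightarrow> node s \<and> node t \<and> ext s t \<and> s \<noteq> t"
  unfolding chain_tree_def by simp

lemma chain_tree_top:
  assumes "(s, t) \<in> chain_tree"
  shows "lt (top s) (top t)"
proof -
  have st: "node s" "node t" "ext s t" "s \<noteq> t" using chain_treeD[OF assms] by auto
  then obtain x where x: "x \<in> t - s" unfolding ext_def by blast
  then have "lt (top s) x" using st(3) top(1)[OF st(1)] unfolding ext_def by blast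
  moreover have "(x, top t) \<in> P" using top(2)[OF st(2)] x by blast
  ultimately show ?thesis by (rule lt_le_trans)
qed

lemma chain_tree_trans: "trans chain_tree"
proof (rule transI)
  fix s t u assume a: "(s, t) \<in> chain_tree" "(t, u) \<in> chain_tree"
  have "s \<noteq> u"
    using lt_trans[OF a[THEN chain_tree_top]] lt_irrefl by blast
  then show "(s, u) \<in> chain_tree"
    using a ext_trans unfolding chain_tree_def by blast
qed

lemma chain_tree_below_linear:
  assumes "(s, u) \<in> chain_tree" "(t, u) \<in> chain_tree"
  shows "s = t \<or> (s, t) \<in> chain_tree \<or> (t, s) \<in> chain_tree"
proof -
  have su: "node s" "node t" "ext s u" "ext t u" using assms unfolding chain_tree_def by auto
  have "s \<subseteq> t \<or> t \<subseteq> s"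
  proof (rule ccontr)
    assume "\<not> ?thesis"
    then obtain x y where xy: "x \<in> s - t" "y \<in> t - s" by blast
    then have "lt y x" "lt x y" using su(3,4) unfolding ext_def by blast+
    then show False using lt_trans lt_irrefl by blast
  qed
  moreover have "ext s t" if "s \<subseteq> t" using that su unfolding ext_def by blast
  moreover have "ext t s" if "t \<subseteq> s" using that su unfolding ext_def by blast
  ultimately show ?thesis using su unfolding chain_tree_def by blast
qed

text \<open>The predecessors of \<open>t\<close> in \<open>Q\<close> have their tops in the
  well-ordered set \<open>t\<close>, and tops increase strictly along the tree. A predecessor with
  the least top is minimal.\<close>

lemma chain_tree_wf: "wf chain_tree"
proof (rule wfI_min)
  fix t Q assume t: "t \<in> (Q :: 'p set set)"
  show "\<exists>z\<in>Q. \<forall>y. (y, z) \<in> chain_tree \<longrightarrow> y \<notin> Q"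
  proof (cases "\<exists>s\<in>Q. (s, t) \<in> chain_tree")
    case True
    define A where "A = {top s | s. s \<in> Q \<and> (s, t) \<in> chain_tree}"
    have "A \<noteq> {}" using True unfolding A_def by blast
    moreover have "A \<subseteq> t"
    proof
      fix x assume "x \<in> A"
      then obtain s where s: "x = top s" "(s, t) \<in> chain_tree" unfolding A_def by blast
      then have "node s" "s \<subseteq> t" using chain_treeD unfolding ext_def by blast+
      then show "x \<in> t" using top(1) s(1) by blast
    qed
    moreover have "wo t" using True unfolding chain_tree_def node_def by blast
    ultimately obtain m where m: "m \<in> A" "\<And>x. x \<in> A \<Longrightarrow> (m, x) \<in> P"
      unfolding wo_def by meson
    then obtain s where s: "s \<in> Q" "(s, t) \<in> chain_tree" "m = top s" unfolding A_def by blast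
    have "y \<notin> Q" if "(y, s) \<in> chain_tree" for y
    proof
      assume "y \<in> Q"
      then have "top y \<in> A" using transD[OF chain_tree_trans that s(2)] unfolding A_def by blast
      then show False using m(2) chain_tree_top[OF that] s(3) lt_not_le by blast
    qed
    then show ?thesis using s(1) by blast
  qed (use t in blast)
qed

lemma node_insert:
  assumes "wo s" "\<And>x. x \<in> s \<Longrightarrow> lt x p" "p \<in> Field P"
  shows "node (insert p s)" "top (insert p s) = p" "ext s (insert p s)"
proof -
  have "wo (insert p s)"
    unfolding wo_def
  proof (intro conjI allI impI)
    show "insert p s \<subseteq> Field P" using assms unfolding wo_def by blast
    fix A assume A: "A \<subseteq> insert p s" "A \<noteq> {}"
    show "\<exists>m\<in>A. \<forall>x\<in>A. (m, x) \<in> P"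
    proof (cases "A \<inter> s = {}")
      case True
      then have "A = {p}" using A by blast
      then show ?thesis using P_refl assms(3) by simp
    next
      case False
      have "A \<inter> s \<subseteq> s" by blast
      with False obtain m where m: "m \<in> A \<inter> s" "\<And>x. x \<in> A \<inter> s \<Longrightarrow> (m, x) \<in> P"
        using assms(1) unfolding wo_def by meson
      have "(m, x) \<in> P" if "x \<in> A" for x
        using m that A(1) assms(2)[of m] unfolding lt_def by blast
      then show ?thesis using m(1) by blast
    qed
  qed
  moreover have le: "(x, p) \<in> P" if "x \<in> insert p s" for x
    using that assms(2,3) P_refl unfolding lt_def by auto
  ultimately show n: "node (insert p s)" unfolding node_def by blast
  show "top (insert p s) = p" by (rule top_eqI[OF n]) (use le in auto)
  show "ext s (insert p s)" using assms(2) unfolding ext_def by auto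
qed

text \<open>
  Below each \<open>p\<close> a well-ordered set is built greedily: at stage \<open>\<eta>\<close> it is prolonged, if possible, to
  a node of colour \<open>\<eta>\<close> below \<open>p\<close>. Once \<open>p\<close> is added on top, the resulting node has a colour \<open>g p\<close>, and
  stage \<open>g p\<close> cannot have succeeded. If \<open>p < q\<close> get the same \<open>g\<close>-colour \<open>\<eta>\<close>, their constructions must differ
  before stage \<open>\<eta>\<close>. But along a long chain each stage becomes constant, because larger points
  have more candidates and the selector prefers the least one.
\<close>

definition candidates :: "('p set \<Rightarrow> 'l) \<Rightarrow> 'p \<Rightarrow> 'l \<Rightarrow> 'p set \<Rightarrow> 'p set set" where
  "candidates f p \<eta> V = {s. node s \<and> f s = \<eta> \<and> lt (top s) p \<and> ext V s}"

definition step :: "('p set set \<Rightarrow> 'p set) \<Rightarrow> ('p set \<Rightarrow> 'l) \<Rightarrow> 'p \<Rightarrow> 'l \<Rightarrow> 'p set \<Rightarrow> 'p set" where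
  "step sel f p \<eta> V = (if candidates f p \<eta> V = {} then V else sel (candidates f p \<eta> V))"

end

text \<open>Taking least elements in one fixed well-order of the whole type makes the choices
  coherent under passing to subsets.\<close>

lemma selector:
  "\<exists>sel :: 'a set \<Rightarrow> 'a. (\<forall>C. C \<noteq> {} \<longrightarrow> sel C \<in> C) \<and>
    (\<forall>C C'. C \<subseteq> C' \<longrightarrow> sel C' \<in> C \<longrightarrow> sel C = sel C')"
proof -
  obtain W :: "'a rel" where W: "well_order_on UNIV W"
    using well_order_on by blast
  then have as: "antisym W" and wfW: "wf (W - Id)" and tot: "(x, y) \<in> W \<or> (y, x) \<in> W" for x y
    unfolding order_on_defs refl_on_def total_on_def by (blast, blast, metis UNIV_I)
  define sel where "sel C = (SOME s. s \<in> C \<and> (\<forall>t\<in>C. (s, t) \<in> W))" for C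
  have sel: "sel C \<in> C \<and> (\<forall>t\<in>C. (sel C, t) \<in> W)" if C: "C \<noteq> {}" for C
    unfolding sel_def
  proof (rule someI_ex)
    obtain x where "x \<in> C" using C by blast
    then obtain s where s: "s \<in> C" "\<And>t. (t, s) \<in> W - Id \<Longrightarrow> t \<notin> C"
      using wfE_min[OF wfW] by metis
    have "(s, t) \<in> W" if "t \<in> C" for t
    proof (cases "s = t")
      case False
      then show ?thesis using tot[of s t] s(2)[of t] that by auto
    qed (use tot in blast)
    with s(1) show "\<exists>s. s \<in> C \<and> (\<forall>t\<in>C. (s, t) \<in> W)" by blast
  qed
  show ?thesis
  proof (intro exI conjI allI impI)
    show "sel C \<in> C" if "C \<noteq> {}" for C using sel[OF that] by blast
    show "sel C = sel C'" if "C \<subseteq> C'" "sel C' \<in> C" for C C'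
    proof (rule antisymD[OF as])
      have C: "C \<noteq> {}" "C' \<noteq> {}" using that by auto
      show "(sel C, sel C') \<in> W" using sel[OF C(1)] that(2) by blast
      show "(sel C', sel C) \<in> W" using sel[OF C(1)] sel[OF C(2)] that(1) by blast
    qed
  qed
qed

section \<open>The greedy construction and its stabilisation along chains\<close>

locale greedy = poset_chains P for P :: "'p rel" +
  fixes \<mu> :: "'l rel" and f :: "'p set \<Rightarrow> 'l" and sel :: "'p set set \<Rightarrow> 'p set"
    and U :: "'p \<Rightarrow> 'l \<Rightarrow> 'p set"
  assumes Cinfinite: "Cinfinite \<mu>"
    and f_Field: "f s \<in> Field \<mu>"
    and f_antichain: "(s, t) \<in> chain_tree \<Longrightarrow> f s \<noteq> f t"
    and sel_in: "C \<noteq> {} \<Longrightarrow> sel C \<in> C"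
    and sel_mono: "C \<subseteq> C' \<Longrightarrow> sel C' \<in> C \<Longrightarrow> sel C = sel C'"
    and U_rec: "U p \<eta> = step sel f p \<eta> (\<Union>\<zeta>\<in>underS \<mu> \<eta>. U p \<zeta>)"
begin

definition V :: "'p \<Rightarrow> 'l \<Rightarrow> 'p set" where
  "V p \<eta> = (\<Union>\<zeta>\<in>underS \<mu> \<eta>. U p \<zeta>)"

lemma U_V: "U p \<eta> = step sel f p \<eta> (V p \<eta>)"
  unfolding V_def by (rule U_rec)

lemma order_\<mu>: "trans \<mu>" "antisym \<mu>" "Total \<mu>" "Refl \<mu>" "wf (\<mu> - Id)"
  using Cinfinite card_order_on_well_order_on[of "Field \<mu>" \<mu>] unfolding order_on_defs by auto

lemma underS_linear:
  assumes "a \<in> Field \<mu>" "b \<in> Field \<mu>"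
  shows "a = b \<or> a \<in> underS \<mu> b \<or> b \<in> underS \<mu> a"
  using assms order_\<mu>(3) unfolding underS_def total_on_def by blast

lemma underS_Field: "a \<in> underS \<mu> b \<Longrightarrow> a \<in> Field \<mu>"
  unfolding underS_def by (auto intro: FieldI1)

lemma U_invariant:
  "wo (U p \<eta>) \<and> (\<forall>x\<in>U p \<eta>. lt x p) \<and> (\<forall>\<zeta>\<in>underS \<mu> \<eta>. ext (U p \<zeta>) (U p \<eta>))"
proof (induction \<eta> rule: wf_induct_rule[OF order_\<mu>(5)])
  case (1 \<eta>)
  have IH: "wo (U p \<zeta>)" "\<forall>x\<in>U p \<zeta>. lt x p" "\<forall>\<zeta>'\<in>underS \<mu> \<zeta>. ext (U p \<zeta>') (U p \<zeta>)"
    if "\<zeta> \<in> underS \<mu> \<eta>" for \<zeta>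
    using 1[of \<zeta>] that unfolding underS_def by auto
  have lin: "ext (U p i) (U p j) \<or> ext (U p j) (U p i)" if "i \<in> underS \<mu> \<eta>" "j \<in> underS \<mu> \<eta>" for i j
    using underS_linear[OF that[THEN underS_Field]] IH(3)[OF that(1)] IH(3)[OF that(2)] ext_refl by blast
  have V: "wo (V p \<eta>)" "\<forall>x\<in>V p \<eta>. lt x p" "\<forall>\<zeta>\<in>underS \<mu> \<eta>. ext (U p \<zeta>) (V p \<eta>)"
    unfolding V_def using wo_UN[of "underS \<mu> \<eta>" "U p"] ext_in_UN[of "underS \<mu> \<eta>" "U p"] lin IH(1,2)
    by blast+
  show ?case
  proof (cases "candidates f p \<eta> (V p \<eta>) = {}")
    case True
    then have eq: "U p \<eta> = V p \<eta>" unfolding U_V[of p \<eta>] step_def by simp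
    show ?thesis unfolding eq using V by blast
  next
    case False
    then have "U p \<eta> \<in> candidates f p \<eta> (V p \<eta>)"
      unfolding U_V[of p \<eta>] step_def using sel_in by simp
    then have U: "node (U p \<eta>)" "lt (top (U p \<eta>)) p" "ext (V p \<eta>) (U p \<eta>)"
      unfolding candidates_def by auto
    show ?thesis
    proof (intro conjI ballI)
      show "wo (U p \<eta>)" using U(1) unfolding node_def by blast
      show "lt x p" if "x \<in> U p \<eta>" for x
        by (rule le_lt_trans[OF top(2)[OF U(1) that] U(2)])
      show "ext (U p \<zeta>) (U p \<eta>)" if "\<zeta> \<in> underS \<mu> \<eta>" for \<zeta>
        using ext_trans[OF _ U(3)] V(3) that by blast
    qed
  qed
qed

definition T :: "'p \<Rightarrow> 'p set" where
  "T p = insert p (\<Union>\<eta>\<in>Field \<mu>. U p \<eta>)"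

definition g :: "'p \<Rightarrow> 'l" where
  "g p = f (T p)"

lemma T:
  assumes "p \<in> Field P"
  shows "node (T p)" "top (T p) = p" "\<eta> \<in> Field \<mu> \<Longrightarrow> ext (U p \<eta>) (T p)" "ext (V p \<eta>) (T p)"
proof -
  have lin: "ext (U p i) (U p j) \<or> ext (U p j) (U p i)" if "i \<in> Field \<mu>" "j \<in> Field \<mu>" for i j
    using underS_linear[OF that] U_invariant ext_refl by blast
  have wo: "wo (\<Union>\<eta>\<in>Field \<mu>. U p \<eta>)"
    using wo_UN[of "Field \<mu>" "U p", OF lin] U_invariant by blast
  have less: "lt x p" if "x \<in> (\<Union>\<eta>\<in>Field \<mu>. U p \<eta>)" for x
    using that U_invariant by blast
  show "node (T p)" "top (T p) = p"
    unfolding T_def using node_insert[OF wo less assms] by auto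
  show ext: "ext (U p \<eta>) (T p)" if "\<eta> \<in> Field \<mu>" for \<eta>
    unfolding T_def
    using ext_trans[OF ext_in_UN[of "Field \<mu>" "U p", OF lin that] node_insert(3)[OF wo less assms]] .
  show "ext (V p \<eta>) (T p)"
    unfolding V_def by (rule ext_UN) (use ext underS_Field in blast)
qed

text \<open>Had this stage succeeded, \<open>U p (g p)\<close> would be a node below
  \<open>T p\<close> in the tree with the same colour, contrary to
  \<open>f_antichain\<close>.\<close>

lemma no_candidates:
  assumes "p \<in> Field P"
  shows "candidates f p (g p) (V p (g p)) = {}"
proof (rule ccontr)
  let ?s = "U p (g p)"
  assume "candidates f p (g p) (V p (g p)) \<noteq> {}"
  then have "?s \<in> candidates f p (g p) (V p (g p))"
    unfolding U_V[of p "g p"] step_def using sel_in by simp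
  then have s: "node ?s" "f ?s = g p" "lt (top ?s) p"
    unfolding candidates_def by auto
  have "?s \<noteq> T p" using s(3) T(2)[OF assms] lt_irrefl by metis
  moreover have "ext ?s (T p)"
    by (rule T(3)[OF assms]) (simp add: g_def f_Field)
  ultimately have "(?s, T p) \<in> chain_tree"
    unfolding chain_tree_def using s(1) T(1)[OF assms] by blast
  then show False using f_antichain s(2) unfolding g_def by blast
qed

text \<open>If the two agreed, \<open>T p\<close> would be a candidate for \<open>q\<close> at stage
  \<open>\<eta>\<close>: it has colour \<open>\<eta>\<close>, its top \<open>p\<close> is below
  \<open>q\<close>, and it prolongs \<open>V q \<eta>\<close>.\<close>

lemma V_differ:
  assumes "lt p q" "g p = \<eta>" "g q = \<eta>"
  shows "V p \<eta> \<noteq> V q \<eta>"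
proof
  assume eq: "V p \<eta> = V q \<eta>"
  have pq: "p \<in> Field P" "q \<in> Field P"
    using assms(1) unfolding lt_def by (auto intro: FieldI1 FieldI2)
  have "T p \<in> candidates f q \<eta> (V q \<eta>)"
    unfolding candidates_def using T(1,2)[OF pq(1)] T(4)[OF pq(1), of \<eta>] assms eq by (simp add: g_def)
  then show False using no_candidates[OF pq(2)] assms(3) by simp
qed

text \<open>Each of the fewer than \<rho> stages before \<open>\<eta>\<close> is eventually constant
  along \<open>Y\<close>, and regularity of \<open>\<rho>\<close> gives a point from which all of
  them are. Two points from there on violate \<open>V_differ\<close>.\<close>

lemma no_long_chain:
  fixes \<rho> :: "'r rel"
  assumes \<rho>: "Cinfinite \<rho>" "regularCard \<rho>" and small: "|underS \<mu> \<eta>| <o \<rho>"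
    and Y: "\<And>a b. (a, b) \<in> \<rho> \<Longrightarrow> a \<noteq> b \<Longrightarrow> lt (Y a) (Y b)"
    and g: "\<And>a. a \<in> Field \<rho> \<Longrightarrow> g (Y a) = \<eta>"
  shows False
proof -
  have ord: "trans \<rho>" "antisym \<rho>" "Refl \<rho>"
    using \<rho>(1) card_order_on_well_order_on[of "Field \<rho>" \<rho>] unfolding order_on_defs by auto
  have V_stable: "\<exists>a\<in>Field \<rho>. \<forall>b. (a, b) \<in> \<rho> \<longrightarrow> V (Y b) \<zeta> = V (Y a) \<zeta>"
    if small': "|underS \<mu> \<zeta>| <o \<rho>"
      and stable: "\<And>\<zeta>'. \<zeta>' \<in> underS \<mu> \<zeta> \<Longrightarrow> \<exists>a\<in>Field \<rho>. \<forall>b. (a, b) \<in> \<rho> \<longrightarrow> U (Y b) \<zeta>' = U (Y a) \<zeta>'" for \<zeta>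
  proof -
    obtain h where h: "\<And>\<zeta>'. \<zeta>' \<in> underS \<mu> \<zeta> \<Longrightarrow> h \<zeta>' \<in> Field \<rho>"
      "\<And>\<zeta>' b. \<zeta>' \<in> underS \<mu> \<zeta> \<Longrightarrow> (h \<zeta>', b) \<in> \<rho> \<Longrightarrow> U (Y b) \<zeta>' = U (Y (h \<zeta>')) \<zeta>'"
      using stable by metis
    obtain a where a: "a \<in> Field \<rho>" "\<And>\<zeta>'. \<zeta>' \<in> underS \<mu> \<zeta> \<Longrightarrow> (h \<zeta>', a) \<in> \<rho>"
      using small_bounded[OF \<rho>, of "h ` underS \<mu> \<zeta>"] small_image[OF small'] h(1) by blast
    have "V (Y b) \<zeta> = V (Y a) \<zeta>" if "(a, b) \<in> \<rho>" for b
    proof -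
      have "U (Y b) \<zeta>' = U (Y a) \<zeta>'" if "\<zeta>' \<in> underS \<mu> \<zeta>" for \<zeta>'
        using h(2)[OF that a(2)[OF that]] h(2)[OF that transD[OF ord(1) a(2)[OF that] \<open>(a, b) \<in> \<rho>\<close>]]
        by simp
      then show ?thesis unfolding V_def by auto
    qed
    then show ?thesis using a(1) by blast
  qed
  have U_stable: "\<exists>a\<in>Field \<rho>. \<forall>b. (a, b) \<in> \<rho> \<longrightarrow> U (Y b) \<zeta> = U (Y a) \<zeta>" if "|underS \<mu> \<zeta>| <o \<rho>" for \<zeta>
    using that
  proof (induction \<zeta> rule: wf_induct_rule[OF order_\<mu>(5)])
    case (1 \<zeta>)
    have "\<exists>a\<in>Field \<rho>. \<forall>b. (a, b) \<in> \<rho> \<longrightarrow> U (Y b) \<zeta>' = U (Y a) \<zeta>'" if \<zeta>': "\<zeta>' \<in> underS \<mu> \<zeta>" for \<zeta>'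
    proof (rule 1(1))
      show "(\<zeta>', \<zeta>) \<in> \<mu> - Id" using \<zeta>' unfolding underS_def by simp
      then show "|underS \<mu> \<zeta>'| <o \<rho>"
        using small_subset[OF 1(2) underS_incr[OF order_\<mu>(1,2)]] by blast
    qed
    from V_stable[OF 1(2) this] obtain a
      where a: "a \<in> Field \<rho>" "\<And>b. (a, b) \<in> \<rho> \<Longrightarrow> V (Y b) \<zeta> = V (Y a) \<zeta>" by blast
    define C where "C b = candidates f (Y b) \<zeta> (V (Y a) \<zeta>)" for b
    have U: "U (Y b) \<zeta> = (if C b = {} then V (Y a) \<zeta> else sel (C b))" if "(a, b) \<in> \<rho>" for b
      unfolding C_def U_V[of "Y b" \<zeta>] step_def a(2)[OF that] ..
    have C_mono: "C b \<subseteq> C b'" if "(b, b') \<in> \<rho>" for b b'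
    proof (cases "b = b'")
      case False
      have "lt (Y b) (Y b')" by (rule Y[OF that False])
      then show ?thesis unfolding C_def candidates_def using lt_trans by blast
    qed simp
    have aa: "(a, a) \<in> \<rho>" using a(1) ord(3) unfolding refl_on_def by blast
    show ?case
    proof (cases "\<forall>b. (a, b) \<in> \<rho> \<longrightarrow> C b = {}")
      case True
      then show ?thesis using U a(1) aa by (intro bexI[of _ a]) auto
    next
      case False
      \<comment> \<open>\<open>D\<close> gathers all candidates that appear from \<open>a\<close>
        on. Once \<open>sel D\<close> has entered the growing sets \<open>C b\<close>, coherence of
        the selector makes it the choice from then on.\<close>
      define D where "D = (\<Union>b\<in>{b. (a, b) \<in> \<rho>}. C b)"
      have "D \<noteq> {}" using False unfolding D_def by blast
      then have "sel D \<in> D" by (rule sel_in)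
      then obtain b where b: "(a, b) \<in> \<rho>" "sel D \<in> C b" unfolding D_def by blast
      have *: "U (Y b') \<zeta> = sel D" if "(b, b') \<in> \<rho>" for b'
      proof -
        have ab': "(a, b') \<in> \<rho>" by (rule transD[OF ord(1) b(1) that])
        have "sel D \<in> C b'" using C_mono[OF that] b(2) by blast
        moreover have "C b' \<subseteq> D" using ab' unfolding D_def by blast
        ultimately show ?thesis using U[OF ab'] sel_mono[of "C b'" D] by auto
      qed
      have "b \<in> Field \<rho>" using b(1) by (rule FieldI2)
      moreover from this have "(b, b) \<in> \<rho>" using ord(3) unfolding refl_on_def by blast
      ultimately show ?thesis using * by (intro bexI[of _ b]) auto
    qed
  qed
  have "|underS \<mu> \<zeta>| <o \<rho>" if "\<zeta> \<in> underS \<mu> \<eta>" for \<zeta>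
    using small_subset[OF small underS_incr[OF order_\<mu>(1,2)]] that unfolding underS_def by blast
  then obtain a where a: "a \<in> Field \<rho>" "\<And>b. (a, b) \<in> \<rho> \<Longrightarrow> V (Y b) \<eta> = V (Y a) \<eta>"
    using V_stable[OF small] U_stable by blast
  obtain b where b: "b \<in> Field \<rho>" "a \<noteq> b" "(a, b) \<in> \<rho>"
    using Cinfinite_limit[OF a(1) \<rho>(1)] by blast
  show False
    using V_differ[OF Y[OF b(3,2)] g[OF a(1)] g[OF b(1)]] a(2)[OF b(3)] by simp
qed

end

section \<open>The arrow hypothesis against antichain colourings of the tree\<close>

context poset_chains
begin

lemma ordLeq_Restr_chain:
  assumes "\<rho> \<le>o Restr P X"
  shows "\<exists>Y. (\<forall>a\<in>Field \<rho>. Y a \<in> X) \<and> (\<forall>a b. (a, b) \<in> \<rho> \<and> a \<noteq> b \<longrightarrow> lt (Y a) (Y b))"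
proof -
  obtain Y where Y: "Well_order \<rho>" "embed \<rho> (Restr P X) Y"
    using assms unfolding ordLeq_def by auto
  have comp: "(Y a, Y b) \<in> Restr P X" if "(a, b) \<in> \<rho>" for a b
    using embed_compat[OF Y(2)] that unfolding compat_def by blast
  have inj: "inj_on Y (Field \<rho>)" by (rule embed_inj_on[OF Y])
  show ?thesis
  proof (intro exI conjI ballI allI impI)
    show "Y a \<in> X" if "a \<in> Field \<rho>" for a
    proof -
      have "(a, a) \<in> \<rho>" using Y(1) that unfolding order_on_defs refl_on_def by blast
      then show ?thesis using comp by blast
    qed
    show "lt (Y a) (Y b)" if "(a, b) \<in> \<rho> \<and> a \<noteq> b" for a b
    proof -
      have ab: "(a, b) \<in> \<rho>" "a \<noteq> b" using that by auto
      then show ?thesis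
      using comp[OF ab(1)] inj_onD[OF inj _ FieldI1[OF ab(1)] FieldI2[OF ab(1)]] ab(2)
        unfolding lt_def by blast
    qed
  qed
qed

text \<open>Points are coloured by \<open>g\<close>. A chain of type \<open>\<mu>\<close> on which
  \<open>g\<close> is constantly \<open>\<eta>\<close> contains one of a regular type above the size
  of \<open>underS \<mu> \<eta>\<close>, which \<open>no_long_chain\<close> excludes.\<close>

lemma chain_arrow_imp_not_special:
  fixes \<mu> :: "'l rel" and f :: "'p set \<Rightarrow> 'l"
  assumes \<mu>: "Cinfinite \<mu>" and arrow: "chain_arrow P \<mu> 1 \<mu>"
    and f: "\<And>s. f s \<in> Field \<mu>" "\<And>s t. (s, t) \<in> chain_tree \<Longrightarrow> f s \<noteq> f t"
  shows False
proof -
  obtain sel :: "'p set set \<Rightarrow> 'p set" where sel: "\<forall>C. C \<noteq> {} \<longrightarrow> sel C \<in> C"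
    "\<forall>C C'. C \<subseteq> C' \<longrightarrow> sel C' \<in> C \<longrightarrow> sel C = sel C'"
    using selector by blast
  have wf: "wf (\<mu> - Id)"
    using \<mu> card_order_on_well_order_on[of "Field \<mu>" \<mu>] unfolding order_on_defs by auto
  have "\<forall>p. \<exists>u. \<forall>\<eta>. u \<eta> = step sel f p \<eta> (\<Union>\<zeta>\<in>underS \<mu> \<eta>. u \<zeta>)"
  proof
    fix p
    show "\<exists>u. \<forall>\<eta>. u \<eta> = step sel f p \<eta> (\<Union>\<zeta>\<in>underS \<mu> \<eta>. u \<zeta>)"
    proof (rule dependent_wf_choice[OF wf, where P = "\<lambda>u \<eta> c. c = step sel f p \<eta> (\<Union>\<zeta>\<in>underS \<mu> \<eta>. u \<zeta>)"])
      fix u v :: "'l \<Rightarrow> 'p set" and \<eta> c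
      assume "\<And>\<zeta>. (\<zeta>, \<eta>) \<in> \<mu> - Id \<Longrightarrow> u \<zeta> = v \<zeta>"
      then have "(\<Union>\<zeta>\<in>underS \<mu> \<eta>. u \<zeta>) = (\<Union>\<zeta>\<in>underS \<mu> \<eta>. v \<zeta>)"
        unfolding underS_def by auto
      then show "(c = step sel f p \<eta> (\<Union>\<zeta>\<in>underS \<mu> \<eta>. u \<zeta>)) = (c = step sel f p \<eta> (\<Union>\<zeta>\<in>underS \<mu> \<eta>. v \<zeta>))"
        by simp
    qed blast
  qed
  then obtain U where U: "\<And>p \<eta>. U p \<eta> = step sel f p \<eta> (\<Union>\<zeta>\<in>underS \<mu> \<eta>. U p \<zeta>)"
    by metis
  interpret greedy P \<mu> f sel U
  proof
    show "Cinfinite \<mu>" by (fact \<mu>)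
    show "f s \<in> Field \<mu>" for s by (fact f(1))
    show "f s \<noteq> f t" if "(s, t) \<in> chain_tree" for s t by (rule f(2)[OF that])
    show "sel C \<in> C" if "C \<noteq> {}" for C using sel(1) that by blast
    show "sel C = sel C'" if "C \<subseteq> C'" "sel C' \<in> C" for C C' using sel(2) that by blast
    show "U p \<eta> = step sel f p \<eta> (\<Union>\<zeta>\<in>underS \<mu> \<eta>. U p \<zeta>)" for p \<eta> by (rule U)
  qed
  have "(\<lambda>X. g (the_elem X)) \<in> nchains P 1 \<rightarrow> Field \<mu>"
    using f(1) unfolding g_def by auto
  from arrow[unfolded chain_arrow_def, rule_format, OF this]
  obtain X \<eta> where X: "X \<in> Chains P" "Restr P X =o \<mu>"
    and \<eta>: "\<forall>Y\<in>nchains (Restr P X) 1. g (the_elem Y) = \<eta>"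
    by blast
  have g\<eta>: "g p = \<eta>" if "p \<in> X" for p
  proof -
    have "{p} \<in> nchains (Restr P X) 1"
      using X(1) that unfolding nchains_def Chains_def by auto
    then have "g (the_elem {p}) = \<eta>" using \<eta> by blast
    then show ?thesis by simp
  qed
  have fin: False if \<rho>: "Cinfinite \<rho>" "regularCard \<rho>" "|underS \<mu> \<eta>| <o \<rho>" "\<rho> \<le>o \<mu>" for \<rho> :: "'r rel"
  proof -
    have "\<rho> \<le>o Restr P X" by (rule ordLeq_ordIso_trans[OF \<rho>(4) ordIso_symmetric[OF X(2)]])
    from ordLeq_Restr_chain[OF this] obtain Y where Y: "\<forall>a\<in>Field \<rho>. Y a \<in> X"
      "\<forall>a b. (a, b) \<in> \<rho> \<and> a \<noteq> b \<longrightarrow> lt (Y a) (Y b)" by blast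
    show False
      by (rule no_long_chain[OF \<rho>(1-3)]) (use Y g\<eta> in auto)
  qed
  \<comment> \<open>The chain is nonempty, so its colour \<open>\<eta>\<close> is a value of
    \<open>g\<close> and hence a stage in \<open>\<mu>\<close>.\<close>
  have "Field (Restr P X) \<noteq> {}"
    using card_of_cong[OF X(2)] \<mu> unfolding cinfinite_def
    by (metis card_of_ordIso_finite finite.emptyI)
  then obtain p where "p \<in> X" using Field_Restr_subset[of P X] by blast
  then have "\<eta> \<in> Field \<mu>" using g\<eta> f(1) unfolding g_def by blast
  from regular_below[OF \<mu> this] show False
    using fin[of natLeq] natLeq_Cinfinite regularCard_natLeq fin[of "cardSuc |underS \<mu> \<eta>|"] by blast
qed

end

section \<open>Transfer from the tree to the partial order\<close>

theorem theorem8p2: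
  fixes \<kappa> :: "'k rel" and P :: "'p rel" and \<xi> :: "'x rel" and k :: nat
  assumes "Cinfinite \<kappa>" and "regularCard \<kappa>"
    and "Partial_order P"
    and "chain_arrow P (weak_power ctwo \<kappa>) 1 (weak_power ctwo \<kappa>)"
    and "Well_order \<xi>"
    and "ctwo ^c |Field \<xi>| <o \<kappa>"
  shows "chain_arrow P (ord_plus \<kappa> \<xi>) 2 (natLeq_on k)"
  unfolding chain_arrow_def
proof (intro allI impI)
  fix c :: "'p set \<Rightarrow> nat"
  assume c: "c \<in> nchains P 2 \<rightarrow> Field (natLeq_on k)"
  interpret poset_chains P by unfold_locales (fact assms(3))
  \<comment> \<open>Comparable nodes have distinct comparable tops, whose colour they
    inherit.\<close>
  define col where "col s t = c {top s, top t}" for s t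
  have Pow: "|Pow (Field \<xi>)| <o \<kappa>"
    by (rule ordIso_ordLess_trans[OF card_of_Pow_ctwo assms(6)])
  interpret tree: coloured_tree_tail chain_tree col \<kappa> \<xi>
    by unfold_locales
      (fact chain_tree_wf chain_tree_trans assms(1,2,5) Pow | rule chain_tree_below_linear, assumption+)+
  have col: "col s t < k" if "(s, t) \<in> chain_tree" for s t
  proof -
    have "lt (top s) (top t)" by (rule chain_tree_top[OF that])
    moreover have "top s \<in> Field P" "top t \<in> Field P"
      using chain_treeD[OF that] top_in_Field by auto
    ultimately have "{top s, top t} \<in> nchains P 2"
      using P_refl unfolding nchains_def Chains_def lt_def by auto
    then show ?thesis
      using c unfolding col_def by (auto simp: Field_natLeq_on)
  qed
  have "\<not> tree.negligible UNIV"
  proof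
    let ?W = "bounded_subsets \<kappa>"
    assume neg: "tree.negligible UNIV"
    from small_set_code[OF assms(1,2)]
    obtain J :: "('k set \<times> nat) set \<times> nat \<Rightarrow> 'k set"
      where J: "inj_on J ({Z. Z \<subseteq> ?W \<times> UNIV \<and> |Z| <o \<kappa>} \<times> UNIV)"
        "J ` ({Z. Z \<subseteq> ?W \<times> UNIV \<and> |Z| <o \<kappa>} \<times> UNIV) \<subseteq> ?W"
      by blast
    from tree.negligible_imp_antichain_code[OF neg J]
    obtain f where f: "range f \<subseteq> ?W" "\<forall>s t. (s, t) \<in> chain_tree \<longrightarrow> f s \<noteq> f t"
      by blast
    note wp = bounded_subsets_le_weak_power[OF assms(1)]
    have "|?W| \<le>o |Field (weak_power ctwo \<kappa>)|"
      by (rule ordLeq_ordIso_trans[OF wp(2) ordIso_symmetric[OF card_of_Field_ordIso[OF conjunct2[OF wp(1)]]]])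
    \<comment> \<open>\<open>e\<close> carries the codes into the field of the weak power, whose
      elements are the colours in the arrow hypothesis.\<close>
    then obtain e where e: "inj_on e ?W" "e ` ?W \<subseteq> Field (weak_power ctwo \<kappa>)"
      by (meson card_of_ordLeq)
    have fW: "f s \<in> ?W" for s using f(1) by blast
    show False
    proof (rule chain_arrow_imp_not_special[OF wp(1) assms(4)])
      show "e (f s) \<in> Field (weak_power ctwo \<kappa>)" for s
        using e(2) fW by blast
      show "e (f s) \<noteq> e (f t)" if "(s, t) \<in> chain_tree" for s t
        using inj_onD[OF e(1) _ fW fW] f(2) that by blast
    qed
  qed
  from tree.homogeneous_chain[OF this col]
  obtain j h where h: "homog chain_tree col j (ord_plus \<kappa> \<xi>) h" by blast
  let ?r = "ord_plus \<kappa> \<xi>"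
  define m where "m = top \<circ> h"
  have wo: "Well_order ?r"
    by (rule Well_order_ord_plus[OF tree.Well_order assms(5)])
  then have total: "Total ?r" unfolding order_on_defs by auto
  have h_tree: "(h a, h b) \<in> chain_tree" "c {m a, m b} = j" if "(a, b) \<in> ?r" "a \<noteq> b" for a b
    using h that unfolding homog_def col_def m_def by auto
  have m_less: "(m a, m b) \<in> P - Id" if "(a, b) \<in> ?r" "a \<noteq> b" for a b
    using chain_tree_top[OF h_tree(1)[OF that]] unfolding m_def lt_def by simp
  have "infinite (Field ?r)"
    using assms(1) unfolding cinfinite_def Field_ord_plus by (auto dest: finite_imageD)
  have m_Field: "m a \<in> Field P" if a: "a \<in> Field ?r" for a
  proof -
    \<comment> \<open>A second point of the infinite field is comparable with \<open>a\<close>,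
      which puts \<open>m a\<close> into a strict pair of \<open>P\<close>.\<close>
    obtain b where "b \<in> Field ?r" "a \<noteq> b"
      using \<open>infinite (Field ?r)\<close> infinite_remove[of "Field ?r" a]
      by (metis Diff_iff all_not_in_conv finite.emptyI insertI1)
    then have "(a, b) \<in> ?r \<or> (b, a) \<in> ?r"
      using total a unfolding total_on_def by blast
    then show ?thesis
      using m_less \<open>a \<noteq> b\<close> by (auto intro: FieldI1 FieldI2)
  qed
  let ?X = "m ` Field ?r"
  note X = well_order_iso_image[OF wo assms(3) m_less m_Field]
  show "\<exists>X\<in>Chains P. Restr P X =o ?r \<and> (\<exists>i. \<forall>Y\<in>nchains (Restr P X) 2. c Y = i)"
  proof (intro bexI[OF _ X(1)] conjI[OF X(2)] exI ballI)
    fix Y assume Y: "Y \<in> nchains (Restr P ?X) 2"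
    then obtain u v where uv: "Y = {u, v}" "u \<noteq> v"
      unfolding nchains_def by (auto simp: card_2_iff)
    have "u \<in> ?X" "v \<in> ?X"
      using Y uv(1) unfolding nchains_def Chains_def by auto
    then obtain a b where ab: "a \<in> Field ?r" "b \<in> Field ?r" "u = m a" "v = m b" by blast
    then have "a \<noteq> b" using uv(2) by blast
    then have "(a, b) \<in> ?r \<or> (b, a) \<in> ?r"
      using total ab(1,2) unfolding total_on_def by blast
    then show "c Y = j"
      using h_tree(2) \<open>a \<noteq> b\<close> unfolding uv(1) ab(3,4) by (metis insert_commute)
  qed
qed

end
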